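(* Let $d\ge 1$, let $\mu \in \mathcal{P}_8(\mathbb{R}^d)$ and let $U \in \mathcal{M}^L_4(\mathcal{P}_2(\mathbb{R}^d))$. Let $X_1,X_2,\ldots$ be i.i.d. random variables with law $\mu$ and, for $N\ge 1$, set $$\mu^{2N}:=\frac{1}{2N}\sum_{i=1}^{2N}\delta_{X_i},\qquad \mu^{2N,(1)}:=\frac1N\sum_{i=1}^{N}\delta_{X_i},\qquad \mu^{2N,(2)}:=\frac1N\sum_{i=N+1}^{2N}\delta_{X_i}.$$ Then there exists a constant $C>0$, not depending on $N$, such that for all $N\ge 1$ $$\mathbb{E}\,\Big| U(\mu^{2N}) - \tfrac12\big(U(\mu^{2N,(1)})+U(\mu^{2N,(2)})\big)\Big|^2 \le \frac{C}{N^2}.$$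
   Context: $\mathcal{P}_k(\mathbb{R}^d)$ is the set of Borel probability measures on $\mathbb{R}^d$ with finite $k$-th moment; $\mathcal{P}_2(\mathbb{R}^d)$ carries the 2-Wasserstein metric $W_2$. Linear functional derivatives. A continuous function $\frac{\delta U}{\delta m}:\mathcal{P}_2(\mathbb{R}^d)\times\mathbb{R}^d\to\mathbb{R}$ is the linear functional derivative of $U:\mathcal{P}_2(\mathbb{R}^d)\to\mathbb{R}$ if (i) for any bounded $\mathcal{K}\subset\mathcal{P}_2(\mathbb{R}^d)$, $y\mapsto\frac{\delta U}{\delta m}(m,y)$ has at most quadratic growth in $y$ uniformly in $m\in\mathcal{K}$, and (ii) for all $m,m'\in\mathcal{P}_2(\mathbb{R}^d)$, $U(m')-U(m)=\int_0^1\int_{\mathbb{R}^d}\frac{\delta U}{\delta m}((1-s)m+sm',y)\,(m'-m)(dy)\,ds$. For $p\ge 2$, provided the $(p-1)$-th order derivative is well defined, the $p$-th order linear functional derivative is a continuous function $\frac{\delta^pU}{\delta m^p}:\mathcal{P}_2(\mathbb{R}^d)\times(\mathbb{R}^d)^{p-1}\times\mathbb{R}^d\to\mathbb{R}$ such that $(y,y')\mapsto\frac{\delta^pU}{\delta m^p}(m,y,y')$ has at most quadratic growth uniformly in $m$ in bounded subsets of $\mathcal{P}_2(\mathbb{R}^d)$, and for all $m,m'$ and $y\in(\mathbb{R}^d)^{p-1}$, $\frac{\delta^{p-1}U}{\delta m^{p-1}}(m',y)-\frac{\delta^{p-1}U}{\delta m^{p-1}}(m,y)=\int_0^1\int_{\mathbb{R}^d}\frac{\delta^pU}{\delta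 m^p}((1-s)m+sm',y,y')\,(m'-m)(dy')\,ds$. The derivatives are normalised by $\frac{\delta^pU}{\delta m^p}(m,y_1,\ldots,y_p)=0$ whenever $y_i=0$ for some $i$. Class $\mathcal{M}^L_k(\mathcal{P}_2(\mathbb{R}^d))$: the functions $U:\mathcal{P}_2(\mathbb{R}^d)\to\mathbb{R}$ that are $k$ times differentiable in the sense of linear functional derivatives and satisfy $\big|\frac{\delta^kU}{\delta m^k}(m,y_1,\ldots,y_k)\big|\le C(|y_1|^k+\cdots+|y_k|^k)$ for some constant $C>0$ not depending on $m,y_1,\ldots,y_k$. *)

theory Defs
  imports "HOL-Probability.Probability"
begin

definition P_mom :: "nat \<Rightarrow> 'a::euclidean_space measure set" where
  "P_mom k = {m. prob_space m \<and> sets m = sets borel \<and> integrable m (\<lambda>x. norm x ^ k)}"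

abbreviation P2 :: "'a::euclidean_space measure set" where
  "P2 \<equiv> P_mom 2"

definition couplings ::
  "'a::euclidean_space measure \<Rightarrow> 'a measure \<Rightarrow> ('a \<times> 'a) measure set" where
  "couplings m m' = {\<pi>. prob_space \<pi> \<and> sets \<pi> = sets (borel \<Otimes>\<^sub>M borel) \<and>
     distr \<pi> borel fst = m \<and> distr \<pi> borel snd = m'}"

text \<open>The infimum is finite whenever both arguments lie in \<open>P2\<close>.\<close>

definition W2 :: "'a::euclidean_space measure \<Rightarrow> 'a measure \<Rightarrow> real" where
  "W2 m m' = sqrt (enn2real
     (INF \<pi>\<in>couplings m m'. \<integral>\<^sup>+z. ennreal (dist (fst z) (snd z) ^ 2) \<partial>\<pi>))"

definition W2_bounded :: "'a::euclidean_space measure set \<Rightarrow> bool" where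
  "W2_bounded K \<longleftrightarrow> K \<subseteq> P2 \<and> (\<exists>m0\<in>P2. \<exists>r. \<forall>m\<in>K. W2 m0 m \<le> r)"

text \<open>The weights \<open>c i\<close> are meant to be nonnegative: \<open>ennreal\<close> sends negative reals to 0.\<close>

definition comb_measure ::
  "'i set \<Rightarrow> ('i \<Rightarrow> real) \<Rightarrow> ('i \<Rightarrow> 'a::euclidean_space measure) \<Rightarrow> 'a measure" where
  "comb_measure I c ms =
     measure_of UNIV (sets borel) (\<lambda>A. \<Sum>i\<in>I. ennreal (c i) * emeasure (ms i) A)"

lemma sets_comb_measure [simp, measurable_cong]: "sets (comb_measure I c ms) = sets borel"
  by (metis comb_measure_def sets.sets_measure_of_eq space_borel)

lemma emeasure_comb_measure:
  assumes ms: "\<And>i. i \<in> I \<Longrightarrow> sets (ms i) = sets borel" and A: "A \<in> sets borel"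
  shows "emeasure (comb_measure I c ms) A = (\<Sum>i\<in>I. ennreal (c i) * emeasure (ms i) A)"
proof (rule emeasure_measure_of[OF comb_measure_def])
  show "sets borel \<subseteq> Pow (UNIV :: 'b set)" by simp
  show "A \<in> sets (comb_measure I c ms)" using A by simp
  show "positive (sets (comb_measure I c ms)) (\<lambda>A. \<Sum>i\<in>I. ennreal (c i) * emeasure (ms i) A)"
    by (simp add: positive_def)
  show "countably_additive (sets (comb_measure I c ms))
      (\<lambda>A. \<Sum>i\<in>I. ennreal (c i) * emeasure (ms i) A)"
  proof (rule countably_additiveI)
    fix B :: "nat \<Rightarrow> 'b set"
    assume B: "range B \<subseteq> sets (comb_measure I c ms)" "disjoint_family B"
    have "(\<Sum>n. \<Sum>i\<in>I. ennreal (c i) * emeasure (ms i) (B n)) =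
        (\<Sum>i\<in>I. \<Sum>n. ennreal (c i) * emeasure (ms i) (B n))"
      by (rule suminf_sum) simp
    also have "\<dots> = (\<Sum>i\<in>I. ennreal (c i) * emeasure (ms i) (\<Union>n. B n))"
      using B ms by (intro sum.cong refl) (simp add: suminf_emeasure)
    finally show "(\<Sum>n. \<Sum>i\<in>I. ennreal (c i) * emeasure (ms i) (B n)) =
        (\<Sum>i\<in>I. ennreal (c i) * emeasure (ms i) (\<Union>n. B n))" .
  qed
qed

text \<open>\<open>(1 - s) m + s m'\<close>, for \<open>0 \<le> s \<le> 1\<close>\<close>

definition mix :: "real \<Rightarrow> 'a::euclidean_space measure \<Rightarrow> 'a measure \<Rightarrow> 'a measure" where
  "mix s m m' = comb_measure UNIV (\<lambda>b. if b then s else 1 - s) (\<lambda>b. if b then m' else m)"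

definition empirical :: "'i set \<Rightarrow> ('i \<Rightarrow> 'a::euclidean_space) \<Rightarrow> 'a measure" where
  "empirical I x = comb_measure I (\<lambda>_. 1 / real (card I)) (\<lambda>i. return borel (x i))"

lemma emeasure_mix:
  assumes "sets m = sets borel" "sets m' = sets borel" "A \<in> sets borel"
  shows "emeasure (mix s m m') A = ennreal (1 - s) * emeasure m A + ennreal s * emeasure m' A"
  unfolding mix_def using assms by (subst emeasure_comb_measure) (auto simp: UNIV_bool)

lemma emeasure_empirical:
  assumes "A \<in> sets borel"
  shows "emeasure (empirical I x) A = (\<Sum>i\<in>I. ennreal (1 / real (card I)) * indicator A (x i))"
  unfolding empirical_def using assms by (subst emeasure_comb_measure) auto

text \<open>
  A function on \<open>P2 \<times> (\<real>\<^sup>d)\<^sup>p\<close> is represented by a curried function whose second argument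
  is a list; only its values on \<open>P2\<close> and on lists of length \<open>p\<close> are relevant.
\<close>

definition continuous_P2 ::
  "nat \<Rightarrow> ('a::euclidean_space measure \<Rightarrow> 'a list \<Rightarrow> real) \<Rightarrow> bool" where
  "continuous_P2 p F \<longleftrightarrow>
     (\<forall>m\<in>P2. \<forall>ys. length ys = p \<longrightarrow> (\<forall>\<epsilon>>0. \<exists>\<delta>>0. \<forall>m'\<in>P2. \<forall>ys'. length ys' = p \<longrightarrow>
        W2 m m' < \<delta> \<longrightarrow> (\<forall>i<p. dist (ys ! i) (ys' ! i) < \<delta>) \<longrightarrow> \<bar>F m' ys' - F m ys\<bar> < \<epsilon>))"

definition quadratic_growth ::
  "nat \<Rightarrow> ('a::euclidean_space measure \<Rightarrow> 'a list \<Rightarrow> real) \<Rightarrow> bool" where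
  "quadratic_growth p F \<longleftrightarrow>
     (\<forall>K. W2_bounded K \<longrightarrow> (\<exists>C. \<forall>m\<in>K. \<forall>ys. length ys = p \<longrightarrow>
        \<bar>F m ys\<bar> \<le> C * (1 + (\<Sum>y\<leftarrow>ys. norm y ^ 2))))"

text \<open>
  \<open>lin_deriv p V W\<close>: the function \<open>W\<close>, of one measure and \<open>Suc p\<close> points, is the normalised
  linear functional derivative of \<open>V\<close>, which depends on one measure and \<open>p\<close> points.
  By continuity and quadratic growth the integrals below exist for \<open>0 \<le> s \<le> 1\<close>.
\<close>

definition lin_deriv ::
  "nat \<Rightarrow> ('a::euclidean_space measure \<Rightarrow> 'a list \<Rightarrow> real) \<Rightarrow> ('a measure \<Rightarrow> 'a list \<Rightarrow> real) \<Rightarrow> bool"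
where
  "lin_deriv p V W \<longleftrightarrow>
     continuous_P2 (Suc p) W \<and>
     quadratic_growth (Suc p) W \<and>
     (\<forall>m\<in>P2. \<forall>m'\<in>P2. \<forall>ys. length ys = p \<longrightarrow>
        ((\<lambda>s. (\<integral>y. W (mix s m m') (ys @ [y]) \<partial>m') - (\<integral>y. W (mix s m m') (ys @ [y]) \<partial>m))
           has_integral (V m' ys - V m ys)) {0..1}) \<and>
     (\<forall>m\<in>P2. \<forall>ys. length ys = Suc p \<longrightarrow> 0 \<in> set ys \<longrightarrow> W m ys = 0)"

text \<open>
  \<open>is_nth_lin_deriv k U W\<close>: \<open>W\<close> is the \<open>k\<close>-th order linear functional derivative of \<open>U\<close>. The
  normalisation makes every derivative unique on \<open>P2\<close> and lists of the right length, so the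
  existential quantifier over the previous derivative involves no choice.
\<close>

primrec is_nth_lin_deriv ::
  "nat \<Rightarrow> ('a::euclidean_space measure \<Rightarrow> real) \<Rightarrow> ('a measure \<Rightarrow> 'a list \<Rightarrow> real) \<Rightarrow> bool"
where
  "is_nth_lin_deriv 0 U W \<longleftrightarrow> (\<forall>m\<in>P2. W m [] = U m)"
| "is_nth_lin_deriv (Suc k) U W \<longleftrightarrow> (\<exists>V. is_nth_lin_deriv k U V \<and> lin_deriv k V W)"

definition class_ML :: "nat \<Rightarrow> ('a::euclidean_space measure \<Rightarrow> real) set" where
  "class_ML k = {U. \<exists>W. is_nth_lin_deriv k U W \<and>
     (\<exists>C>0. \<forall>m\<in>P2. \<forall>ys. length ys = k \<longrightarrow> \<bar>W m ys\<bar> \<le> C * (\<Sum>y\<leftarrow>ys. norm y ^ k))}"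

end

theory Submission
  imports Defs
begin

text \<open>
  Pair the point \<open>X i\<close> of the first half of the sample with the point \<open>X (N + i)\<close> of the
  second half. For \<open>t\<close> in the cube \<open>[-1, 1]^N\<close> let \<open>m t\<close> be the measure that gives
  mass \<open>(1 + t i) / (2 N)\<close> to \<open>X i\<close> and \<open>(1 - t i) / (2 N)\<close> to
  \<open>X (N + i)\<close>, and put \<open>\<phi> t = U (m t)\<close>. The random variable to be estimated is
  \<open>\<phi> 0 - (\<phi> 1 + \<phi> (-1)) / 2\<close>, where \<open>1\<close> is the vector of ones. Exchanging the two points of some
  of the pairs does not change the law of an independent, identically distributed sample, and it replaces
  the vector \<open>1\<close> by a vector \<open>\<epsilon>\<close> of signs. Hence the expected square equals the expectation of the
  average of \<open>(\<phi> 0 - (\<phi> \<epsilon> + \<phi> (-\<epsilon>)) / 2)\<^sup>2\<close> over all \<open>\<epsilon>\<close>.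

  For a fixed sample this average is an elementary quantity on the discrete cube
  (\<open>cube_antithetic\<close>). The even part of \<open>\<phi>\<close> has no first-order fluctuations: its
  discrete derivatives are odd, so two applications of the Poincare inequality of the cube
  bound its variance by the sum of the squares of the \<open>N\<^sup>2\<close> mixed second differences of \<open>\<phi>\<close>
  (\<open>cube_variance_even\<close>). Its mean differs from \<open>\<phi> 0\<close> by at most the sum of the \<open>N\<close>
  pure second differences (\<open>cube_mean_deviation\<close>). A second difference of \<open>\<phi>\<close> moves masses
  of order \<open>1 / N\<close> twice, so it is of order \<open>1 / N\<^sup>2\<close> times a bound on the second linear functional
  derivative (\<open>second_difference_bound\<close>). The squared bias and the variance are then both of
  order \<open>1 / N\<^sup>2\<close>.

  The bound on the second derivative comes from the growth condition on the fourth one. Integrating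
  twice along segments that start at the Dirac mass at 0, where the derivatives grow at most
  quadratically, gives a bound by the fourth powers of the points and the fourth moment of the
  measure (\<open>quartic_growth_lin_deriv\<close>). It enters squared, and this is where the eighth moment
  of \<open>\<mu>\<close> is needed.
\<close>

section \<open>Integration against combinations of measures\<close>

lemma space_comb_measure [simp]: "space (comb_measure I c ms) = UNIV"
  using sets_eq_imp_space_eq[OF sets_comb_measure, of I c ms] by simp

lemma sets_mix [simp, measurable_cong]: "sets (mix s m m') = sets borel"
  and space_mix [simp]: "space (mix s m m') = UNIV"
  by (simp_all add: mix_def)

lemma sets_empirical [simp, measurable_cong]: "sets (empirical I x) = sets borel"
  and space_empirical [simp]: "space (empirical I x) = UNIV"
  by (simp_all add: empirical_def)

text \<open>
  Both sides are additive, homogeneous and monotone-continuous in \<open>f\<close>, so it suffices that they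
  agree on indicators, which is the defining formula for the measure of a set.
\<close>

lemma nn_integral_comb_measure:
  assumes ms: "\<And>i. i \<in> I \<Longrightarrow> sets (ms i) = sets borel"
    and f [measurable]: "f \<in> borel_measurable borel"
  shows "(\<integral>\<^sup>+y. f y \<partial>comb_measure I c ms) = (\<Sum>i\<in>I. ennreal (c i) * (\<integral>\<^sup>+y. f y \<partial>ms i))"
  using f
proof (induction rule: borel_measurable_induct)
  case (cong f g)
  then have "f = g" by (auto simp: space_borel)
  with cong show ?case by simp
next
  case (set A)
  have "(\<integral>\<^sup>+y. indicator A y \<partial>ms i) = emeasure (ms i) A" if "i \<in> I" for i
    using set ms[OF that] by simp
  with set ms show ?case
    by (simp add: emeasure_comb_measure)
next
  case (mult u v)
  have "(\<integral>\<^sup>+y. v * u y \<partial>ms i) = v * (\<integral>\<^sup>+y. u y \<partial>ms i)" if "i \<in> I" for i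
    using mult(2) measurable_cong_sets[OF ms[OF that] refl]
    by (intro nn_integral_cmult) auto
  moreover have "(\<integral>\<^sup>+y. v * u y \<partial>comb_measure I c ms) = v * (\<integral>\<^sup>+y. u y \<partial>comb_measure I c ms)"
    using mult(2) by (intro nn_integral_cmult) (simp add: measurable_cong_sets[OF sets_comb_measure refl])
  ultimately show ?case
    using mult by (simp add: sum_distrib_left mult_ac)
next
  case (add u v)
  have "v \<in> borel_measurable (ms i)" "u \<in> borel_measurable (ms i)" if "i \<in> I" for i
    using add(1,3) by (simp_all add: measurable_cong_sets[OF ms[OF that] refl])
  then have "(\<integral>\<^sup>+y. v y + u y \<partial>ms i) = (\<integral>\<^sup>+y. v y \<partial>ms i) + (\<integral>\<^sup>+y. u y \<partial>ms i)" if "i \<in> I" for i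
    using that by (intro nn_integral_add) auto
  moreover have "(\<integral>\<^sup>+y. v y + u y \<partial>comb_measure I c ms) =
      (\<integral>\<^sup>+y. v y \<partial>comb_measure I c ms) + (\<integral>\<^sup>+y. u y \<partial>comb_measure I c ms)"
    using add by (intro nn_integral_add) (simp_all add: measurable_cong_sets[OF sets_comb_measure refl])
  ultimately show ?case
    using add by (simp add: sum.distrib distrib_left)
next
  case (seq F)
  have F: "F n \<in> borel_measurable (ms i)" if "i \<in> I" for n i
    using seq(1) measurable_cong_sets[OF ms[OF that] refl] by auto
  have ms_sup: "(\<integral>\<^sup>+y. (SUP n. F n) y \<partial>ms i) = (SUP n. \<integral>\<^sup>+y. F n y \<partial>ms i)" if "i \<in> I" for i
    using nn_integral_monotone_convergence_SUP[OF seq(3) F[OF that]] by (simp add: image_comp)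
  have inc: "incseq (\<lambda>n. ennreal (c i) * (\<integral>\<^sup>+y. F n y \<partial>ms i))" for i
    using seq(3) by (auto simp: mono_def le_fun_def intro!: mult_left_mono nn_integral_mono)
  have "(\<integral>\<^sup>+y. (SUP n. F n) y \<partial>comb_measure I c ms) = (SUP n. \<integral>\<^sup>+y. F n y \<partial>comb_measure I c ms)"
    using nn_integral_monotone_convergence_SUP[OF seq(3), of "comb_measure I c ms"] seq(1)
    by (simp add: measurable_cong_sets[OF sets_comb_measure refl] image_comp)
  also have "\<dots> = (SUP n. \<Sum>i\<in>I. ennreal (c i) * (\<integral>\<^sup>+y. F n y \<partial>ms i))"
    using seq by simp
  also have "\<dots> = (\<Sum>i\<in>I. SUP n. ennreal (c i) * (\<integral>\<^sup>+y. F n y \<partial>ms i))"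
    using inc by (intro ennreal_SUP_sum)
  also have "\<dots> = (\<Sum>i\<in>I. ennreal (c i) * (\<integral>\<^sup>+y. (SUP n. F n) y \<partial>ms i))"
    by (intro sum.cong refl) (subst ms_sup, assumption, rule SUP_mult_left_ennreal[symmetric])
  finally show ?case .
qed

lemma comb_measure_integral:
  fixes f :: "'a::euclidean_space \<Rightarrow> real"
  assumes fin: "finite I" and c: "\<And>i. i \<in> I \<Longrightarrow> 0 \<le> c i"
    and ms: "\<And>i. i \<in> I \<Longrightarrow> sets (ms i) = sets borel"
    and f: "\<And>i. i \<in> I \<Longrightarrow> integrable (ms i) f"
    and [measurable]: "f \<in> borel_measurable borel"
  shows "integrable (comb_measure I c ms) f"
    and "integral\<^sup>L (comb_measure I c ms) f = (\<Sum>i\<in>I. c i * integral\<^sup>L (ms i) f)"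
proof -
  have pos: "(\<integral>\<^sup>+y. ennreal (f y) \<partial>ms i) < \<infinity>" and neg: "(\<integral>\<^sup>+y. ennreal (- f y) \<partial>ms i) < \<infinity>"
    if "i \<in> I" for i
    using f[OF that] by (auto simp: real_integrable_def top.not_eq_extremum)
  have eq: "(\<integral>\<^sup>+y. ennreal (f y) \<partial>comb_measure I c ms) = (\<Sum>i\<in>I. ennreal (c i) * (\<integral>\<^sup>+y. ennreal (f y) \<partial>ms i))"
    "(\<integral>\<^sup>+y. ennreal (- f y) \<partial>comb_measure I c ms) = (\<Sum>i\<in>I. ennreal (c i) * (\<integral>\<^sup>+y. ennreal (- f y) \<partial>ms i))"
    by (rule nn_integral_comb_measure[OF ms]; simp)+
  show int: "integrable (comb_measure I c ms) f"
    unfolding real_integrable_def using fin pos neg eq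
    by (auto simp: ennreal_mult_eq_top_iff top.not_eq_extremum[symmetric] measurable_cong_sets[OF sets_comb_measure refl])
  have "enn2real (\<Sum>i\<in>I. ennreal (c i) * u i) = (\<Sum>i\<in>I. c i * enn2real (u i))"
    if "\<And>i. i \<in> I \<Longrightarrow> u i < \<infinity>" for u
    using that c by (subst enn2real_sum) (auto simp: ennreal_mult_less_top enn2real_mult)
  then show "integral\<^sup>L (comb_measure I c ms) f = (\<Sum>i\<in>I. c i * integral\<^sup>L (ms i) f)"
    using pos neg by (simp add: real_lebesgue_integral_def[OF int] eq real_lebesgue_integral_def[OF f]
        right_diff_distrib sum_subtractf)
qed

lemma mix_integral:
  fixes f :: "'a::euclidean_space \<Rightarrow> real"
  assumes "0 \<le> s" "s \<le> 1" "sets m = sets borel" "sets m' = sets borel"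
    "integrable m f" "integrable m' f" "f \<in> borel_measurable borel"
  shows "integrable (mix s m m') f"
    and "integral\<^sup>L (mix s m m') f = (1 - s) * integral\<^sup>L m f + s * integral\<^sup>L m' f"
  using comb_measure_integral[of UNIV "\<lambda>b. if b then s else 1 - s" "\<lambda>b. if b then m' else m" f] assms
  by (auto simp: mix_def UNIV_bool)

lemma prob_space_mix:
  assumes "0 \<le> s" "s \<le> 1" "sets m = sets borel" "sets m' = sets borel" "prob_space m" "prob_space m'"
  shows "prob_space (mix s m m')"
proof
  have "emeasure m UNIV = 1" "emeasure m' UNIV = 1"
    using prob_space.emeasure_space_1[OF assms(5)] prob_space.emeasure_space_1[OF assms(6)]
      sets_eq_imp_space_eq[OF assms(3)] sets_eq_imp_space_eq[OF assms(4)] by simp_all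
  then show "emeasure (mix s m m') (space (mix s m m')) = 1"
    using assms by (simp add: emeasure_mix flip: ennreal_plus)
qed

lemma mix_in_P_mom:
  assumes "0 \<le> s" "s \<le> 1" "m \<in> P_mom k" "m' \<in> P_mom k"
  shows "mix s m m' \<in> P_mom k"
  using assms prob_space_mix[of s m m'] mix_integral(1)[of s m m' "\<lambda>x. norm x ^ k"]
  by (auto simp: P_mom_def)

lemma P_mom_mono:
  assumes "j \<le> k" "m \<in> P_mom k"
  shows "m \<in> P_mom j"
proof -
  interpret prob_space m using assms by (simp add: P_mom_def)
  have sets: "sets m = sets borel" and int: "integrable m (\<lambda>x. norm x ^ k)"
    using assms by (auto simp: P_mom_def)
  have "norm (norm x ^ j) \<le> norm (1 + norm x ^ k)" for x :: 'a
  proof (cases "norm x \<le> 1")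
    case True
    then show ?thesis by (simp add: power_le_one add_increasing2)
  next
    case False
    then have "norm x ^ j \<le> norm x ^ k" using power_increasing[OF assms(1), of "norm x"] by simp
    then show ?thesis by (simp add: add_increasing)
  qed
  moreover have "(\<lambda>x. norm x ^ j) \<in> borel_measurable m"
    unfolding measurable_cong_sets[OF sets refl] by measurable
  moreover have "integrable m (\<lambda>x. 1 + norm x ^ k)" using int by simp
  ultimately have "integrable m (\<lambda>x. norm x ^ j)"
    by (blast intro: Bochner_Integration.integrable_bound AE_I2)
  then show ?thesis using assms by (simp add: P_mom_def)
qed

lemma integrable_return:
  fixes f :: "'a::topological_space \<Rightarrow> real"
  assumes [measurable]: "f \<in> borel_measurable borel"
  shows "integrable (return borel x) f"
  by (auto simp: real_integrable_def nn_integral_return)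

lemma return_in_P_mom: "return borel x \<in> P_mom k"
proof -
  interpret prob_space "return borel x" by (rule prob_space_return) simp
  show ?thesis
    by (auto simp: P_mom_def integrable_return prob_space_axioms)
qed

text \<open>
  Every measure that the argument meets along a segment between empirical measures is supported on
  one fixed finite family of points. Keeping the points and varying only the coefficients turns
  \<open>U\<close> into a function on a simplex; indexing by \<open>I\<close> rather than by the support
  allows points to coincide.
\<close>

definition point_masses :: "'i set \<Rightarrow> ('i \<Rightarrow> 'a) \<Rightarrow> ('i \<Rightarrow> real) \<Rightarrow> 'a::euclidean_space measure" where
  "point_masses I x c = comb_measure I c (\<lambda>i. return borel (x i))"

text \<open>
  The cap \<open>b\<close> on the individual coefficients keeps the moments of the measure
  below \<open>b\<close> times the sum of the powers over all points; it is a convex condition, so it holds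
  along segments.
\<close>

definition weights :: "'i set \<Rightarrow> real \<Rightarrow> ('i \<Rightarrow> real) set" where
  "weights I b = {c. (\<forall>i\<in>I. 0 \<le> c i \<and> c i \<le> b) \<and> sum c I = 1}"

lemma empirical_eq_point_masses: "empirical I x = point_masses I x (\<lambda>_. 1 / real (card I))"
  by (simp add: empirical_def point_masses_def)

lemma sets_point_masses [simp, measurable_cong]: "sets (point_masses I x c) = sets borel"
  and space_point_masses [simp]: "space (point_masses I x c) = UNIV"
  by (simp_all add: point_masses_def)

lemma emeasure_point_masses:
  "A \<in> sets borel \<Longrightarrow> emeasure (point_masses I x c) A = (\<Sum>i\<in>I. ennreal (c i) * indicator A (x i))"
  unfolding point_masses_def by (subst emeasure_comb_measure) auto

lemma point_masses_integral:
  fixes f :: "'a::euclidean_space \<Rightarrow> real"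
  assumes "finite I" "c \<in> weights I b" "f \<in> borel_measurable borel"
  shows "integrable (point_masses I x c) f"
    and "integral\<^sup>L (point_masses I x c) f = (\<Sum>i\<in>I. c i * f (x i))"
  using comb_measure_integral[of I c "\<lambda>i. return borel (x i)" f] assms
  by (auto simp: point_masses_def weights_def integrable_return integral_return)

lemma point_masses_in_P_mom:
  assumes "finite I" "c \<in> weights I b"
  shows "point_masses I x c \<in> P_mom k"
proof -
  have "prob_space (point_masses I x c)"
    using assms by (intro prob_spaceI) (auto simp: emeasure_point_masses weights_def)
  then show ?thesis
    using point_masses_integral(1)[OF assms, of "\<lambda>x. norm x ^ k"] by (auto simp: P_mom_def)
qed

lemma weights_convex:
  assumes "0 \<le> s" "s \<le> 1" "c \<in> weights I b" "c' \<in> weights I b"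
  shows "(\<lambda>i. (1 - s) * c i + s * c' i) \<in> weights I b"
  using assms convex_bound_le[of _ b _ "1 - s" s]
  by (auto simp: weights_def sum.distrib simp flip: sum_distrib_left)

text \<open>
  Mixing measures becomes interpolating coefficients, so linear functional derivatives become
  ordinary derivatives along segments of the simplex.
\<close>

lemma mix_point_masses:
  assumes "0 \<le> s" "s \<le> 1" "c \<in> weights I b" "c' \<in> weights I b"
  shows "mix s (point_masses I x c) (point_masses I x c') = point_masses I x (\<lambda>i. (1 - s) * c i + s * c' i)"
proof (rule measure_eqI)
  fix A assume "A \<in> sets (mix s (point_masses I x c) (point_masses I x c'))"
  then have A: "A \<in> sets borel" by simp
  have "ennreal ((1 - s) * c i + s * c' i) = ennreal (1 - s) * ennreal (c i) + ennreal s * ennreal (c' i)"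
    if "i \<in> I" for i
    using assms that by (auto simp: weights_def ennreal_plus ennreal_mult)
  with A show "emeasure (mix s (point_masses I x c) (point_masses I x c')) A =
      emeasure (point_masses I x (\<lambda>i. (1 - s) * c i + s * c' i)) A"
    by (simp add: emeasure_mix emeasure_point_masses sum_distrib_left sum.distrib[symmetric]
        distrib_right mult.assoc cong: sum.cong)
qed simp

section \<open>Averages over the sign cube\<close>

text \<open>
  The sign cube on an index set \<open>I\<close> is represented by the subsets \<open>S\<close> of
  \<open>I\<close>, the set of coordinates with sign \<open>+1\<close>; complement in \<open>I\<close> is negation.
\<close>

definition cube_avg :: "'i set \<Rightarrow> ('i set \<Rightarrow> real) \<Rightarrow> real" where
  "cube_avg I f = (\<Sum>S\<in>Pow I. f S) / 2 ^ card I"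

lemma cube_avg_empty [simp]: "cube_avg {} f = f {}"
  by (simp add: cube_avg_def)

lemma cube_avg_insert:
  assumes "finite I" "i \<notin> I"
  shows "cube_avg (insert i I) f = (cube_avg I f + cube_avg I (\<lambda>S. f (insert i S))) / 2"
proof -
  have "sum f (Pow (insert i I)) = sum f (Pow I) + sum f (insert i ` Pow I)"
    unfolding Pow_insert using assms by (intro sum.union_disjoint) auto
  also have "sum f (insert i ` Pow I) = (\<Sum>S\<in>Pow I. f (insert i S))"
    using assms by (subst sum.reindex) (auto simp: inj_on_def)
  finally show ?thesis
    using assms by (simp add: cube_avg_def field_simps)
qed

lemma cube_avg_cong: "(\<And>S. S \<subseteq> I \<Longrightarrow> f S = g S) \<Longrightarrow> cube_avg I f = cube_avg I g"
  by (simp add: cube_avg_def)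

lemma cube_avg_mono: "(\<And>S. S \<subseteq> I \<Longrightarrow> f S \<le> g S) \<Longrightarrow> cube_avg I f \<le> cube_avg I g"
  unfolding cube_avg_def by (intro divide_right_mono sum_mono) auto

lemma cube_avg_add: "cube_avg I (\<lambda>S. f S + g S) = cube_avg I f + cube_avg I g"
  by (simp add: cube_avg_def sum.distrib add_divide_distrib)

lemma cube_avg_diff: "cube_avg I (\<lambda>S. f S - g S) = cube_avg I f - cube_avg I g"
  by (simp add: cube_avg_def sum_subtractf diff_divide_distrib)

lemma cube_avg_cmult: "cube_avg I (\<lambda>S. a * f S) = a * cube_avg I f"
  by (simp add: cube_avg_def sum_distrib_left)

lemma cube_avg_const: "finite I \<Longrightarrow> cube_avg I (\<lambda>_. a) = a"
  by (simp add: cube_avg_def card_Pow)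

lemma cube_avg_compl: "cube_avg I (\<lambda>S. f (I - S)) = cube_avg I f"
  unfolding cube_avg_def
  by (rule arg_cong2[where f = "(/)"] sum.reindex_bij_witness[where i = "\<lambda>S. I - S" and j = "\<lambda>S. I - S"] refl)+
     auto

lemma cube_avg_power2_le:
  assumes "finite I"
  shows "(cube_avg I f)\<^sup>2 \<le> cube_avg I (\<lambda>S. (f S)\<^sup>2)"
proof -
  let ?a = "cube_avg I f"
  have "0 \<le> cube_avg I (\<lambda>S. (f S - ?a)\<^sup>2)"
    by (simp add: cube_avg_def sum_nonneg)
  also have "\<dots> = cube_avg I (\<lambda>S. (f S)\<^sup>2 - (2 * ?a) * f S + ?a\<^sup>2)"
    by (intro cube_avg_cong) (simp add: power2_eq_square algebra_simps)
  also have "\<dots> = cube_avg I (\<lambda>S. (f S)\<^sup>2) - ?a\<^sup>2"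
    using assms unfolding cube_avg_add cube_avg_diff cube_avg_cmult
    by (simp add: cube_avg_const power2_eq_square)
  finally show ?thesis by simp
qed

text \<open>
  The Poincare inequality of the cube: averaging out one coordinate at a time decomposes the
  variance, and by Jensen's inequality each coordinate accounts for at most the mean square of the
  discrete derivative along it.
\<close>

lemma cube_poincare:
  assumes "finite I"
  shows "cube_avg I (\<lambda>S. (f S)\<^sup>2) - (cube_avg I f)\<^sup>2
    \<le> (\<Sum>i\<in>I. cube_avg I (\<lambda>S. ((f (insert i S) - f (S - {i})) / 2)\<^sup>2))"
  using assms
proof (induction I arbitrary: f rule: finite_induct)
  case empty
  then show ?case by simp
next
  case (insert i I)
  let ?g = "\<lambda>S. f (insert i S)"
  let ?D = "\<lambda>f j S. ((f (insert j S) - f (S - {j})) / 2)\<^sup>2"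
  have i_term: "cube_avg (insert i I) (?D f i) = cube_avg I (\<lambda>S. (?g S - f S)\<^sup>2) / 4"
  proof -
    have "cube_avg I (?D f i) = cube_avg I (\<lambda>S. 1 / 4 * (?g S - f S)\<^sup>2)"
    proof (rule cube_avg_cong)
      fix S assume "S \<subseteq> I"
      then have "S - {i} = S" using insert.hyps(2) by auto
      then show "?D f i S = 1 / 4 * (?g S - f S)\<^sup>2" by (simp add: power_divide)
    qed
    moreover have "cube_avg I (\<lambda>S. ?D f i (insert i S)) = cube_avg I (\<lambda>S. 1 / 4 * (?g S - f S)\<^sup>2)"
    proof (rule cube_avg_cong)
      fix S assume "S \<subseteq> I"
      then have "insert i S - {i} = S" using insert.hyps(2) by auto
      then show "?D f i (insert i S) = 1 / 4 * (?g S - f S)\<^sup>2" by (simp add: power_divide)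
    qed
    ultimately show ?thesis
      using insert.hyps cube_avg_cmult[of I "1 / 4" "\<lambda>S. (?g S - f S)\<^sup>2"] by (simp add: cube_avg_insert)
  qed
  have j_term: "cube_avg (insert i I) (?D f j) = (cube_avg I (?D f j) + cube_avg I (?D ?g j)) / 2"
    if "j \<in> I" for j
  proof -
    have "i \<noteq> j" using that insert.hyps by auto
    then have "insert i S - {j} = insert i (S - {j})" for S by auto
    then show ?thesis
      using insert.hyps by (simp add: cube_avg_insert insert_commute)
  qed
  have jensen: "(cube_avg I ?g - cube_avg I f)\<^sup>2 \<le> cube_avg I (\<lambda>S. (?g S - f S)\<^sup>2)"
    using cube_avg_power2_le[OF insert.hyps(1), of "\<lambda>S. ?g S - f S"] by (simp add: cube_avg_diff)
  have "cube_avg (insert i I) (\<lambda>S. (f S)\<^sup>2) - (cube_avg (insert i I) f)\<^sup>2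
     = ((cube_avg I (\<lambda>S. (f S)\<^sup>2) - (cube_avg I f)\<^sup>2) + (cube_avg I (\<lambda>S. (?g S)\<^sup>2) - (cube_avg I ?g)\<^sup>2)) / 2
       + (cube_avg I ?g - cube_avg I f)\<^sup>2 / 4"
    using insert.hyps by (simp add: cube_avg_insert power2_eq_square field_simps)
  also have "\<dots> \<le> ((\<Sum>j\<in>I. cube_avg I (?D f j)) + (\<Sum>j\<in>I. cube_avg I (?D ?g j))) / 2
       + cube_avg I (\<lambda>S. (?g S - f S)\<^sup>2) / 4"
    using insert.IH[of f] insert.IH[of ?g] jensen by (intro add_mono divide_right_mono) auto
  also have "\<dots> = (\<Sum>j\<in>insert i I. cube_avg (insert i I) (?D f j))"
    using insert.hyps by (simp add: i_term j_term sum.distrib flip: sum_divide_distrib)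
  finally show ?case .
qed

definition signs :: "'i set \<Rightarrow> 'i \<Rightarrow> real" where
  "signs S = (\<lambda>i. if i \<in> S then 1 else -1)"

lemma signs_insert: "signs (insert i S) = (signs S)(i := 1)"
  and signs_remove: "signs (S - {i}) = (signs S)(i := -1)"
  by (auto simp: signs_def fun_eq_iff)

text \<open>
  Averaging \<open>\<phi>\<close> over a sign vector and its negative leaves an even function \<open>e\<close>, whose discrete
  derivatives \<open>g i\<close> are odd and hence have mean zero. The Poincare inequality, applied to
  \<open>e\<close> and then to each \<open>g i\<close>, therefore bounds the variance by mixed second
  differences alone; for a function that is not even the first-order differences would survive.
\<close>

lemma cube_variance_even:
  fixes \<phi> :: "('i \<Rightarrow> real) \<Rightarrow> real"
  assumes I: "finite I"
    and mixed: "\<And>t i j. \<lbrakk>\<forall>k\<in>I. \<bar>t k\<bar> \<le> 1; i \<in> I; j \<in> I; i \<noteq> j\<rbrakk> \<Longrightarrow>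
      \<bar>\<phi> (t(i := 1, j := 1)) - \<phi> (t(i := 1, j := -1)) - \<phi> (t(i := -1, j := 1)) + \<phi> (t(i := -1, j := -1))\<bar>
        \<le> 4 * A i j"
  defines "e \<equiv> \<lambda>S. (\<phi> (signs S) + \<phi> (signs (I - S))) / 2"
  shows "cube_avg I (\<lambda>S. (e S)\<^sup>2) - (cube_avg I e)\<^sup>2 \<le> (\<Sum>i\<in>I. \<Sum>j\<in>I. (A i j)\<^sup>2)"
proof -
  define g where "g i S = (e (insert i S) - e (S - {i})) / 2" for i S
  have even: "e (I - S) = e S" if "S \<subseteq> I" for S
    using that by (simp add: e_def double_diff add.commute)
  have mean: "cube_avg I (g i) = 0" if "i \<in> I" for i
  proof -
    have "cube_avg I (g i) = cube_avg I (\<lambda>S. g i (I - S))"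
      by (rule cube_avg_compl[symmetric])
    also have "\<dots> = cube_avg I (\<lambda>S. (-1) * g i S)"
    proof (rule cube_avg_cong)
      fix S assume S: "S \<subseteq> I"
      have "insert i (I - S) = I - (S - {i})" "I - S - {i} = I - insert i S"
        using that by auto
      then show "g i (I - S) = (-1) * g i S"
        using S that even[of "S - {i}"] even[of "insert i S"] by (auto simp: g_def)
    qed
    finally show ?thesis unfolding cube_avg_cmult by simp
  qed
  have second: "\<bar>(g i (insert j S) - g i (S - {j})) / 2\<bar> \<le> \<bar>A i j\<bar>"
    if ij: "i \<in> I" "j \<in> I" and S: "S \<subseteq> I" for i j S
  proof (cases "i = j")
    case True
    then show ?thesis by (simp add: g_def)
  next
    case False
    let ?d = "\<lambda>t. \<phi> (t(i := 1, j := 1)) - \<phi> (t(i := 1, j := -1)) - \<phi> (t(i := -1, j := 1)) + \<phi> (t(i := -1, j := -1))"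
    have d: "\<bar>?d (signs T)\<bar> \<le> 4 * A i j" for T
      using ij False by (intro mixed) (auto simp: signs_def)
    have eI: "e (insert i T) = (\<phi> ((signs T)(i := 1)) + \<phi> ((signs (I - T))(i := -1))) / 2"
      "e (T - {i}) = (\<phi> ((signs T)(i := -1)) + \<phi> ((signs (I - T))(i := 1))) / 2" for T
    proof -
      have "I - insert i T = I - T - {i}" "I - (T - {i}) = insert i (I - T)" using ij by auto
      then show "e (insert i T) = (\<phi> ((signs T)(i := 1)) + \<phi> ((signs (I - T))(i := -1))) / 2"
        "e (T - {i}) = (\<phi> ((signs T)(i := -1)) + \<phi> ((signs (I - T))(i := 1))) / 2"
        by (simp_all only: e_def signs_insert signs_remove)
    qed
    have eJ: "signs (I - insert j S) = (signs (I - S))(j := -1)" "signs (I - (S - {j})) = (signs (I - S))(j := 1)"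
      using ij by (auto simp: signs_def fun_eq_iff)
    have "(g i (insert j S) - g i (S - {j})) / 2 = (?d (signs S) + ?d (signs (I - S))) / 8"
      using False by (simp add: g_def eI eJ signs_insert signs_remove fun_upd_twist field_simps)
    with d[of S] d[of "I - S"] show ?thesis by simp
  qed
  have "cube_avg I (\<lambda>S. (e S)\<^sup>2) - (cube_avg I e)\<^sup>2 \<le> (\<Sum>i\<in>I. cube_avg I (\<lambda>S. (g i S)\<^sup>2))"
    using cube_poincare[OF I, of e] by (simp add: g_def)
  also have "\<dots> \<le> (\<Sum>i\<in>I. \<Sum>j\<in>I. (A i j)\<^sup>2)"
  proof (rule sum_mono)
    fix i assume i: "i \<in> I"
    have "cube_avg I (\<lambda>S. (g i S)\<^sup>2) \<le> (\<Sum>j\<in>I. cube_avg I (\<lambda>S. ((g i (insert j S) - g i (S - {j})) / 2)\<^sup>2))"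
      using cube_poincare[OF I, of "g i"] mean[OF i] by simp
    also have "\<dots> \<le> (\<Sum>j\<in>I. cube_avg I (\<lambda>_. (A i j)\<^sup>2))"
      using second[OF i] by (intro sum_mono cube_avg_mono) (simp only: abs_le_square_iff)
    finally show "cube_avg I (\<lambda>S. (g i S)\<^sup>2) \<le> (\<Sum>j\<in>I. (A i j)\<^sup>2)"
      using I by (simp add: cube_avg_const)
  qed
  finally show ?thesis .
qed

text \<open>
  Coordinates are averaged one at a time. Replacing one random sign by 0 costs, on average over the
  sign, half a pure second difference in that coordinate. The parameter \<open>t\<close> is arbitrary
  because the coordinates not yet treated may have any values.
\<close>

lemma cube_mean_deviation:
  fixes \<phi> :: "('i \<Rightarrow> real) \<Rightarrow> real"
  assumes "finite J" "J \<subseteq> I"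
    and pure: "\<And>t i. \<lbrakk>\<forall>k\<in>I. \<bar>t k\<bar> \<le> 1; i \<in> I\<rbrakk> \<Longrightarrow>
      \<bar>\<phi> (t(i := 1)) - 2 * \<phi> (t(i := 0)) + \<phi> (t(i := -1))\<bar> \<le> B i"
    and t: "\<forall>k\<in>I. \<bar>t k\<bar> \<le> 1"
  shows "\<bar>cube_avg J (\<lambda>S. \<phi> (override_on t (signs S) J)) - \<phi> (override_on t (\<lambda>_. 0) J)\<bar> \<le> (\<Sum>j\<in>J. B j) / 2"
  using assms(1,2) t
proof (induction J arbitrary: t rule: finite_induct)
  case empty
  then show ?case by simp
next
  case (insert j J)
  have j: "j \<in> I" using insert.prems by auto
  let ?L = "\<lambda>t. cube_avg J (\<lambda>S. \<phi> (override_on t (signs S) J))"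
  let ?z = "\<lambda>t. override_on t (\<lambda>_. 0) J"
  have "cube_avg J (\<lambda>S. \<phi> (override_on t (signs S) (insert j J))) = ?L (t(j := -1))"
    "cube_avg J (\<lambda>S. \<phi> (override_on t (signs (insert j S)) (insert j J))) = ?L (t(j := 1))"
    using insert.hyps
    by (auto intro!: cube_avg_cong arg_cong[where f = \<phi>] simp: fun_eq_iff override_on_def signs_def)
  then have avg: "cube_avg (insert j J) (\<lambda>S. \<phi> (override_on t (signs S) (insert j J)))
      = (?L (t(j := -1)) + ?L (t(j := 1))) / 2"
    using insert.hyps by (simp add: cube_avg_insert)
  have IH: "\<bar>?L (t(j := a)) - \<phi> (?z (t(j := a)))\<bar> \<le> (\<Sum>j\<in>J. B j) / 2" if "\<bar>a\<bar> \<le> 1" for a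
    using insert.prems that by (intro insert.IH) auto
  have upd: "?z (t(j := a)) = (?z t)(j := a)" for a
    using insert.hyps by (auto simp: fun_eq_iff override_on_def)
  have "\<bar>\<phi> ((?z t)(j := 1)) - 2 * \<phi> ((?z t)(j := 0)) + \<phi> ((?z t)(j := -1))\<bar> \<le> B j"
    using insert.prems j by (intro pure) (auto simp: override_on_def)
  moreover have "override_on t (\<lambda>_. 0) (insert j J) = (?z t)(j := 0)"
    by (auto simp: fun_eq_iff override_on_def)
  ultimately have "\<bar>\<phi> ((?z t)(j := 1)) - 2 * \<phi> (override_on t (\<lambda>_. 0) (insert j J)) + \<phi> ((?z t)(j := -1))\<bar> \<le> B j"
    by simp
  moreover have "\<bar>(a + b) / 2 - z\<bar> \<le> (d + D) / 2"
    if "\<bar>p - 2 * z + q\<bar> \<le> d" "\<bar>a - q\<bar> \<le> D / 2" "\<bar>b - p\<bar> \<le> D / 2" for a b p q z d D :: real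
    using that unfolding abs_le_iff by (auto simp: field_simps)
  ultimately show ?case
    using IH[of 1] IH[of "-1"] insert.hyps unfolding upd avg by simp
qed

text \<open>
  Bias and variance: the left side is the squared distance from \<open>\<phi> 0\<close> to the mean of the even part
  of \<open>\<phi>\<close>, which is the mean of \<open>\<phi>\<close>, plus the variance of the even part. Both are controlled
  by second differences.
\<close>

lemma cube_antithetic:
  fixes \<phi> :: "('i \<Rightarrow> real) \<Rightarrow> real"
  assumes I: "finite I"
    and mixed: "\<And>t i j. \<lbrakk>\<forall>k\<in>I. \<bar>t k\<bar> \<le> 1; i \<in> I; j \<in> I; i \<noteq> j\<rbrakk> \<Longrightarrow>
      \<bar>\<phi> (t(i := 1, j := 1)) - \<phi> (t(i := 1, j := -1)) - \<phi> (t(i := -1, j := 1)) + \<phi> (t(i := -1, j := -1))\<bar>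
        \<le> 4 * A i j"
    and pure: "\<And>t i. \<lbrakk>\<forall>k\<in>I. \<bar>t k\<bar> \<le> 1; i \<in> I\<rbrakk> \<Longrightarrow>
      \<bar>\<phi> (t(i := 1)) - 2 * \<phi> (t(i := 0)) + \<phi> (t(i := -1))\<bar> \<le> A i i"
    and local: "\<And>t t'. (\<And>i. i \<in> I \<Longrightarrow> t i = t' i) \<Longrightarrow> \<phi> t = \<phi> t'"
  shows "cube_avg I (\<lambda>S. (\<phi> (\<lambda>_. 0) - (\<phi> (signs S) + \<phi> (signs (I - S))) / 2)\<^sup>2)
    \<le> (\<Sum>i\<in>I. A i i)\<^sup>2 / 4 + (\<Sum>i\<in>I. \<Sum>j\<in>I. (A i j)\<^sup>2)"
proof -
  define e where "e S = (\<phi> (signs S) + \<phi> (signs (I - S))) / 2" for S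
  let ?z = "\<phi> (\<lambda>_. 0)" and ?m = "cube_avg I e"
  have "?m = (cube_avg I (\<lambda>S. \<phi> (signs S)) + cube_avg I (\<lambda>S. \<phi> (signs (I - S)))) / 2"
    unfolding cube_avg_add[symmetric] by (simp add: e_def cube_avg_def sum_divide_distrib mult.commute)
  then have m: "?m = cube_avg I (\<lambda>S. \<phi> (signs S))"
    using cube_avg_compl[of I "\<lambda>S. \<phi> (signs S)"] by simp
  have "\<bar>cube_avg I (\<lambda>S. \<phi> (override_on (\<lambda>_. 0) (signs S) I)) - \<phi> (override_on (\<lambda>_. 0) (\<lambda>_. 0) I)\<bar>
      \<le> (\<Sum>j\<in>I. A j j) / 2"
    by (rule cube_mean_deviation[OF I order_refl pure]) auto
  moreover have "\<phi> (override_on (\<lambda>_. 0) (signs S) I) = \<phi> (signs S)" for S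
    by (rule local) (simp add: override_on_def)
  moreover have "override_on (\<lambda>_. 0) (\<lambda>_. 0) I = (\<lambda>_. 0::real)"
    by (simp add: override_on_def)
  ultimately have "\<bar>?z - ?m\<bar> \<le> (\<Sum>j\<in>I. A j j) / 2"
    unfolding m by (simp add: abs_minus_commute)
  then have bias: "(?z - ?m)\<^sup>2 \<le> (\<Sum>i\<in>I. A i i)\<^sup>2 / 4"
    using power_mono[of "\<bar>?z - ?m\<bar>" _ 2] by (fastforce simp: power_divide)
  have "cube_avg I (\<lambda>S. (?z - e S)\<^sup>2) = cube_avg I (\<lambda>S. ?z\<^sup>2 - (2 * ?z) * e S + (e S)\<^sup>2)"
    by (intro cube_avg_cong) (simp add: power2_eq_square algebra_simps)
  also have "\<dots> = (?z - ?m)\<^sup>2 + (cube_avg I (\<lambda>S. (e S)\<^sup>2) - ?m\<^sup>2)"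
    unfolding cube_avg_add cube_avg_diff cube_avg_cmult cube_avg_const[OF I]
    by (simp add: power2_eq_square algebra_simps)
  also have "\<dots> \<le> (\<Sum>i\<in>I. A i i)\<^sup>2 / 4 + (\<Sum>i\<in>I. \<Sum>j\<in>I. (A i j)\<^sup>2)"
    using bias cube_variance_even[OF I mixed] unfolding e_def by (intro add_mono) auto
  finally show ?thesis by (simp add: e_def)
qed

section \<open>Linear functional derivatives on finitely supported measures\<close>

lemma W2_le:
  assumes "\<pi> \<in> couplings m m'" "(\<integral>\<^sup>+z. ennreal (dist (fst z) (snd z) ^ 2) \<partial>\<pi>) \<le> ennreal (r\<^sup>2)" "0 \<le> r"
  shows "W2 m m' \<le> r"
proof -
  have "(INF \<pi>\<in>couplings m m'. \<integral>\<^sup>+z. ennreal (dist (fst z) (snd z) ^ 2) \<partial>\<pi>) \<le> ennreal (r\<^sup>2)"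
    using assms by (intro INF_lower2)
  then have "enn2real (INF \<pi>\<in>couplings m m'. \<integral>\<^sup>+z. ennreal (dist (fst z) (snd z) ^ 2) \<partial>\<pi>) \<le> r\<^sup>2"
    by (intro enn2real_leI) auto
  then show ?thesis
    unfolding W2_def using assms(3) by (simp add: real_le_lsqrt)
qed

lemma W2_refl_le:
  assumes m: "prob_space m" "sets m = sets borel"
  shows "W2 m m \<le> 0"
proof (rule W2_le)
  let ?\<pi> = "distr m (borel \<Otimes>\<^sub>M borel) (\<lambda>x. (x, x))"
  interpret prob_space m by fact
  have [measurable_cong]: "sets m = sets borel" by fact
  have "distr m borel (\<lambda>x. x) = m"
    using m by (intro distr_id2) simp
  then show "?\<pi> \<in> couplings m m"
    by (auto simp: couplings_def distr_distr comp_def intro!: prob_space_distr)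
  show "(\<integral>\<^sup>+z. ennreal (dist (fst z) (snd z) ^ 2) \<partial>?\<pi>) \<le> ennreal (0\<^sup>2)"
    by (subst nn_integral_distr) auto
qed simp

lemma nn_integral_mix:
  assumes "sets m = sets borel" "sets m' = sets borel" "f \<in> borel_measurable borel"
  shows "(\<integral>\<^sup>+y. f y \<partial>mix s m m') = ennreal (1 - s) * (\<integral>\<^sup>+y. f y \<partial>m) + ennreal s * (\<integral>\<^sup>+y. f y \<partial>m')"
  unfolding mix_def using assms by (subst nn_integral_comb_measure) (auto simp: UNIV_bool)

lemma nn_integral_empirical:
  assumes "f \<in> borel_measurable borel"
  shows "(\<integral>\<^sup>+y. f y \<partial>empirical J x) = (\<Sum>i\<in>J. ennreal (1 / real (card J)) * f (x i))"
  unfolding empirical_def using assms by (subst nn_integral_comb_measure) (auto simp: nn_integral_return)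

lemma uniform_weights: "finite J \<Longrightarrow> J \<noteq> {} \<Longrightarrow> (\<lambda>_. 1 / real (card J)) \<in> weights J (1 / real (card J))"
  by (auto simp: weights_def)

lemma empirical_in_P_mom: "finite J \<Longrightarrow> J \<noteq> {} \<Longrightarrow> empirical J x \<in> P_mom k"
  unfolding empirical_eq_point_masses
  by (rule point_masses_in_P_mom[OF _ uniform_weights])

text \<open>
  The coupling leaves the proportion \<open>1 - s\<close> of each atom where it is and moves the
  proportion \<open>s\<close> from \<open>x i\<close> to \<open>x' i\<close>, so no mass moves further
  than \<open>r\<close>. It is itself a mixture of two empirical measures on the product space.
\<close>

lemma W2_empirical_mix_le:
  fixes x x' :: "'i \<Rightarrow> 'a::euclidean_space"
  assumes J: "finite J" "J \<noteq> {}" and s: "0 \<le> s" "s \<le> 1"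
    and r: "\<And>i. i \<in> J \<Longrightarrow> dist (x i) (x' i) \<le> r"
  shows "W2 (empirical J x) (mix s (empirical J x) (empirical J x')) \<le> r"
proof (rule W2_le)
  show "0 \<le> r" using J r order_trans[OF zero_le_dist] by blast
  let ?p = "empirical J (\<lambda>i. (x i, x i))" and ?q = "empirical J (\<lambda>i. (x i, x' i))"
  let ?\<pi> = "mix s ?p ?q"
  have pq: "prob_space ?p" "prob_space ?q"
    using empirical_in_P_mom[OF J, of _ 0] by (auto simp: P_mom_def)
  have "prob_space ?\<pi>"
    using s pq by (intro prob_space_mix) auto
  moreover have proj: "fst \<in> measurable ?\<pi> borel" "snd \<in> measurable ?\<pi> borel"
    using borel_measurable_continuous_onI[OF continuous_on_fst[OF continuous_on_id]]
      borel_measurable_continuous_onI[OF continuous_on_snd[OF continuous_on_id]]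
    by (simp_all add: measurable_cong_sets[OF sets_mix refl])
  moreover have "distr ?\<pi> borel fst = empirical J x"
  proof (rule measure_eqI)
    fix B assume "B \<in> sets (distr ?\<pi> borel fst)"
    then have B: "B \<in> sets borel" by simp
    then have B': "fst -` B \<in> sets (borel :: ('a \<times> 'a) measure)"
      using measurable_sets[OF borel_measurable_continuous_onI[OF continuous_on_fst[OF continuous_on_id]] B] by simp
    have i: "indicator (fst -` B) (x i, z) = (indicator B (x i) :: ennreal)" for i and z :: 'a
      by (simp add: indicator_def)
    have "emeasure (distr ?\<pi> borel fst) B = (ennreal (1 - s) + ennreal s) * emeasure (empirical J x) B"
      using B B' by (simp add: emeasure_distr proj emeasure_mix emeasure_empirical i distrib_right)
    also have "ennreal (1 - s) + ennreal s = 1" using s by (simp flip: ennreal_plus)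
    finally show "emeasure (distr ?\<pi> borel fst) B = emeasure (empirical J x) B" by simp
  qed simp
  moreover have "distr ?\<pi> borel snd = mix s (empirical J x) (empirical J x')"
  proof (rule measure_eqI)
    fix B assume "B \<in> sets (distr ?\<pi> borel snd)"
    then have B: "B \<in> sets borel" by simp
    then have B': "snd -` B \<in> sets (borel :: ('a \<times> 'a) measure)"
      using measurable_sets[OF borel_measurable_continuous_onI[OF continuous_on_snd[OF continuous_on_id]] B] by simp
    have i: "indicator (snd -` B) (z, y) = (indicator B y :: ennreal)" for y z :: 'a
      by (simp add: indicator_def)
    show "emeasure (distr ?\<pi> borel snd) B = emeasure (mix s (empirical J x) (empirical J x')) B"
      using B B' by (simp add: emeasure_distr proj emeasure_mix emeasure_empirical i)
  qed simp
  ultimately show "?\<pi> \<in> couplings (empirical J x) (mix s (empirical J x) (empirical J x'))"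
    unfolding couplings_def borel_prod mem_Collect_eq by (intro conjI sets_mix)
  have "continuous_on UNIV (\<lambda>z :: 'a \<times> 'a. dist (fst z) (snd z) ^ 2)"
    by (intro continuous_intros)
  then have "(\<lambda>z. dist (fst z) (snd z) ^ 2) \<in> borel_measurable (borel :: ('a \<times> 'a) measure)"
    by (rule borel_measurable_continuous_onI)
  note meas = measurable_compose[OF this measurable_ennreal]
  let ?n = "ennreal (1 / real (card J))"
  have "(\<integral>\<^sup>+z. ennreal (dist (fst z) (snd z) ^ 2) \<partial>?\<pi>)
      = ennreal s * (\<Sum>i\<in>J. ?n * ennreal (dist (x i) (x' i) ^ 2))"
    unfolding nn_integral_mix[OF sets_empirical sets_empirical meas] nn_integral_empirical[OF meas] by simp
  also have "\<dots> \<le> 1 * (\<Sum>i\<in>J. ?n * ennreal (r\<^sup>2))"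
  proof (intro mult_mono sum_mono order_refl)
    show "ennreal s \<le> 1" using s by simp
    show "ennreal (dist (x i) (x' i) ^ 2) \<le> ennreal (r\<^sup>2)" if "i \<in> J" for i
      using r[OF that] by (intro ennreal_leI power_mono) auto
  qed auto
  also have "\<dots> = (\<Sum>i\<in>J. ?n) * ennreal (r\<^sup>2)"
    by (simp only: sum_distrib_right mult_1)
  also have "(\<Sum>i\<in>J. ?n) = ennreal (\<Sum>i\<in>J. 1 / real (card J))"
    by (rule sum_ennreal) simp
  also have "(\<Sum>i\<in>J. 1 / real (card J)) = 1" using J by simp
  also have "ennreal 1 * ennreal (r\<^sup>2) = ennreal (r\<^sup>2)" by simp
  finally show "(\<integral>\<^sup>+z. ennreal (dist (fst z) (snd z) ^ 2) \<partial>?\<pi>) \<le> ennreal (r\<^sup>2)" .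
qed

text \<open>
  Continuity in the measure and the points jointly is used only with the measure held fixed, which
  is legitimate because the diagonal coupling gives distance zero from a measure to itself.
\<close>

lemma continuous_P2_section_measurable:
  assumes W: "continuous_P2 (Suc p) W" and m: "m \<in> P2" and ys: "length ys = p"
  shows "(\<lambda>y. W m (ys @ [y])) \<in> borel_measurable borel"
proof (intro borel_measurable_continuous_onI)
  show "continuous_on UNIV (\<lambda>y. W m (ys @ [y]))"
    unfolding continuous_on_iff
  proof (intro ballI allI impI)
    fix y :: 'a and e :: real assume "0 < e"
    then obtain d where "d > 0" and d: "\<And>zs. length zs = Suc p \<Longrightarrow> W2 m m < d \<Longrightarrow>
        (\<forall>i<Suc p. dist ((ys @ [y]) ! i) (zs ! i) < d) \<Longrightarrow> \<bar>W m zs - W m (ys @ [y])\<bar> < e"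
      using W m ys unfolding continuous_P2_def by (metis length_append_singleton)
    have "W2 m m < d"
      using W2_refl_le[of m] m \<open>d > 0\<close> by (auto simp: P_mom_def)
    then have "\<bar>W m (ys @ [z]) - W m (ys @ [y])\<bar> < e" if "dist z y < d" for z
      using that ys \<open>d > 0\<close> by (intro d) (auto simp: nth_append dist_commute less_Suc_eq)
    then show "\<exists>d>0. \<forall>z\<in>UNIV. dist z y < d \<longrightarrow> dist (W m (ys @ [z])) (W m (ys @ [y])) < e"
      using \<open>d > 0\<close> by (auto simp: dist_real_def)
  qed
qed

lemma has_integral_unit_bound:
  fixes f :: "real \<Rightarrow> real"
  assumes "(f has_integral i) {0..1}" "0 \<le> B" "\<And>s. s \<in> {0..1} \<Longrightarrow> norm (f s) \<le> B"
  shows "norm i \<le> B"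
  using has_integral_bound_real[OF assms(2) finite.emptyI assms(1)] assms(3) by simp

lemma lin_deriv_point_masses:
  fixes x :: "'i \<Rightarrow> 'a::euclidean_space"
  assumes VW: "lin_deriv p V W" and J: "finite J"
    and c: "c \<in> weights J b" "c' \<in> weights J b" and ys: "length ys = p"
  shows "((\<lambda>s. \<Sum>i\<in>J. (c' i - c i) * W (point_masses J x (\<lambda>i. (1 - s) * c i + s * c' i)) (ys @ [x i]))
    has_integral (V (point_masses J x c') ys - V (point_masses J x c) ys)) {0..1}"
proof -
  let ?m = "point_masses J x c" and ?m' = "point_masses J x c'"
  have P2: "point_masses J x c \<in> P2" if "c \<in> weights J b" for c
    using J that by (rule point_masses_in_P_mom)
  have "((\<lambda>s. (\<integral>y. W (mix s ?m ?m') (ys @ [y]) \<partial>?m') - (\<integral>y. W (mix s ?m ?m') (ys @ [y]) \<partial>?m))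
           has_integral (V ?m' ys - V ?m ys)) {0..1}"
    using VW P2 c ys unfolding lin_deriv_def by blast
  then show ?thesis
  proof (rule has_integral_eq[rotated])
    fix s :: real assume "s \<in> {0..1}"
    then have s: "0 \<le> s" "s \<le> 1" by auto
    let ?ms = "point_masses J x (\<lambda>i. (1 - s) * c i + s * c' i)"
    have "(\<lambda>y. W ?ms (ys @ [y])) \<in> borel_measurable borel"
      using VW ys P2[OF weights_convex[OF s c]] unfolding lin_deriv_def
      by (intro continuous_P2_section_measurable) auto
    then show "(\<integral>y. W (mix s ?m ?m') (ys @ [y]) \<partial>?m') - (\<integral>y. W (mix s ?m ?m') (ys @ [y]) \<partial>?m)
        = (\<Sum>i\<in>J. (c' i - c i) * W ?ms (ys @ [x i]))"
      using c J by (simp add: mix_point_masses[OF s c] point_masses_integral(2)[OF J] left_diff_distrib sum_subtractf)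
  qed
qed

text \<open>
  Taylor's formula to second order, exact at every base point: along the direction \<open>b\<close>
  the difference of \<open>V0\<close> is an integral of \<open>V1\<close>, and the difference of
  \<open>V1\<close> along \<open>a\<close> is an integral of \<open>V2\<close>. All base points are coefficient
  vectors in \<open>weights J \<beta>\<close>, so one bound \<open>K\<close> on \<open>V2\<close> there is enough.
  The directions \<open>a\<close> and \<open>b\<close> may coincide.
\<close>

lemma second_difference_bound:
  fixes x :: "'i \<Rightarrow> 'a::euclidean_space"
  assumes V: "lin_deriv 0 V0 V1" "lin_deriv 1 V1 V2" and J: "finite J"
    and c: "c \<in> weights J \<beta>" "(\<lambda>i. c i + a i) \<in> weights J \<beta>"
      "(\<lambda>i. c i + b i) \<in> weights J \<beta>" "(\<lambda>i. c i + a i + b i) \<in> weights J \<beta>"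
    and K: "\<And>c i j. \<lbrakk>c \<in> weights J \<beta>; i \<in> J; j \<in> J\<rbrakk> \<Longrightarrow> \<bar>V2 (point_masses J x c) [x i, x j]\<bar> \<le> K i j"
  shows "\<bar>V0 (point_masses J x (\<lambda>i. c i + a i + b i)) [] - V0 (point_masses J x (\<lambda>i. c i + a i)) []
      - V0 (point_masses J x (\<lambda>i. c i + b i)) [] + V0 (point_masses J x c) []\<bar>
    \<le> (\<Sum>i\<in>J. \<Sum>j\<in>J. \<bar>b i\<bar> * \<bar>a j\<bar> * K i j)"
proof -
  let ?P = "point_masses J x"
  let ?c = "\<lambda>s i. c i + s * b i" and ?ca = "\<lambda>s i. c i + a i + s * b i"
  have inner: "\<bar>V1 (?P c2) [x i] - V1 (?P c1) [x i]\<bar> \<le> (\<Sum>j\<in>J. \<bar>a j\<bar> * K i j)"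
    if w: "c1 \<in> weights J \<beta>" "c2 \<in> weights J \<beta>" and a: "\<And>j. c2 j - c1 j = a j" and i: "i \<in> J" for c1 c2 i
  proof -
    let ?f = "\<lambda>s. \<Sum>j\<in>J. (c2 j - c1 j) * V2 (?P (\<lambda>j. (1 - s) * c1 j + s * c2 j)) ([x i] @ [x j])"
    have "norm (V1 (?P c2) [x i] - V1 (?P c1) [x i]) \<le> (\<Sum>j\<in>J. \<bar>a j\<bar> * K i j)"
    proof (rule has_integral_unit_bound)
      show "(?f has_integral (V1 (?P c2) [x i] - V1 (?P c1) [x i])) {0..1}"
        by (rule lin_deriv_point_masses[OF V(2) J w]) simp
      show "norm (?f s) \<le> (\<Sum>j\<in>J. \<bar>a j\<bar> * K i j)" if "s \<in> {0..1}" for s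
      proof (rule sum_norm_le)
        fix j assume "j \<in> J"
        then have "\<bar>V2 (?P (\<lambda>j. (1 - s) * c1 j + s * c2 j)) [x i, x j]\<bar> \<le> K i j"
          using that w i by (intro K weights_convex) auto
        then show "norm ((c2 j - c1 j) * V2 (?P (\<lambda>j. (1 - s) * c1 j + s * c2 j)) ([x i] @ [x j]))
            \<le> \<bar>a j\<bar> * K i j"
          by (simp add: a abs_mult mult_left_mono)
      qed
      show "0 \<le> (\<Sum>j\<in>J. \<bar>a j\<bar> * K i j)"
        using K[OF w(1) i] order_trans[OF abs_ge_zero] by (intro sum_nonneg mult_nonneg_nonneg) auto
    qed
    then show ?thesis by simp
  qed
  have w: "?c s \<in> weights J \<beta>" "?ca s \<in> weights J \<beta>" if "s \<in> {0..1}" for s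
    using that weights_convex[OF _ _ c(1,3), of s] weights_convex[OF _ _ c(2,4), of s]
    by (simp_all add: algebra_simps)
  let ?g = "\<lambda>s. \<Sum>i\<in>J. b i * (V1 (?P (?ca s)) [x i] - V1 (?P (?c s)) [x i])"
  let ?B = "\<Sum>i\<in>J. \<Sum>j\<in>J. \<bar>b i\<bar> * \<bar>a j\<bar> * K i j"
  have h1: "((\<lambda>s. \<Sum>i\<in>J. b i * V1 (?P (?ca s)) [x i]) has_integral
      (V0 (?P (\<lambda>i. c i + a i + b i)) [] - V0 (?P (\<lambda>i. c i + a i)) [])) {0..1}"
    using lin_deriv_point_masses[OF V(1) J c(2,4), of "[]" x] by (simp add: algebra_simps)
  have h2: "((\<lambda>s. \<Sum>i\<in>J. b i * V1 (?P (?c s)) [x i]) has_integral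
      (V0 (?P (\<lambda>i. c i + b i)) [] - V0 (?P c) [])) {0..1}"
    using lin_deriv_point_masses[OF V(1) J c(1,3), of "[]" x] by (simp add: algebra_simps)
  have hg: "(?g has_integral
      ((V0 (?P (\<lambda>i. c i + a i + b i)) [] - V0 (?P (\<lambda>i. c i + a i)) [])
        - (V0 (?P (\<lambda>i. c i + b i)) [] - V0 (?P c) []))) {0..1}"
    using has_integral_diff[OF h1 h2] by (simp add: right_diff_distrib sum_subtractf)
  have bound: "norm (?g s) \<le> ?B" if s: "s \<in> {0..1}" for s
  proof -
    have "norm (?g s) \<le> (\<Sum>i\<in>J. \<bar>b i\<bar> * (\<Sum>j\<in>J. \<bar>a j\<bar> * K i j))"
    proof (rule sum_norm_le)
      fix i assume "i \<in> J"
      then have "\<bar>V1 (?P (?ca s)) [x i] - V1 (?P (?c s)) [x i]\<bar> \<le> (\<Sum>j\<in>J. \<bar>a j\<bar> * K i j)"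
        using w[OF s] by (intro inner) auto
      then show "norm (b i * (V1 (?P (?ca s)) [x i] - V1 (?P (?c s)) [x i])) \<le> \<bar>b i\<bar> * (\<Sum>j\<in>J. \<bar>a j\<bar> * K i j)"
        by (simp add: abs_mult mult_left_mono)
    qed
    then show ?thesis by (simp add: sum_distrib_left mult.assoc)
  qed
  have nonneg: "0 \<le> ?B"
    using K[OF c(1)] order_trans[OF abs_ge_zero] by (intro sum_nonneg mult_nonneg_nonneg) auto
  show ?thesis
    using has_integral_unit_bound[OF hg nonneg bound] by (simp add: algebra_simps)
qed

text \<open>
  Unlike \<open>quadratic_growth\<close> this bound is not restricted to bounded sets of measures: the
  dependence on the measure is explicit, through its fourth moment. The price is the fourth power
  of the points.
\<close>

definition quartic_growth :: "nat \<Rightarrow> ('a::euclidean_space measure \<Rightarrow> 'a list \<Rightarrow> real) \<Rightarrow> bool" where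
  "quartic_growth p W \<longleftrightarrow> (\<exists>C\<ge>0. \<forall>m\<in>P_mom 4. \<forall>ys. length ys = p \<longrightarrow>
     \<bar>W m ys\<bar> \<le> C * (1 + (\<integral>y. norm y ^ 4 \<partial>m) + (\<Sum>y\<leftarrow>ys. norm y ^ 4)))"

text \<open>
  Integrate \<open>W\<close> along the segment from the Dirac mass at 0 to \<open>m\<close>. At the Dirac
  mass itself \<open>V\<close> grows at most quadratically. Along the segment the fourth moment is at most
  that of \<open>m\<close>, and the Dirac mass contributes nothing to the integral because \<open>W\<close> is
  normalised to vanish when its last point is 0.
\<close>

lemma quartic_growth_lin_deriv:
  fixes V W :: "'a::euclidean_space measure \<Rightarrow> 'a list \<Rightarrow> real"
  assumes W: "quartic_growth (Suc p) W" and VW: "lin_deriv p V W" and V: "quadratic_growth p V"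
  shows "quartic_growth p V"
proof -
  obtain C where C: "C \<ge> 0" "\<And>m ys. m \<in> P_mom 4 \<Longrightarrow> length ys = Suc p \<Longrightarrow>
      \<bar>W m ys\<bar> \<le> C * (1 + (\<integral>y. norm y ^ 4 \<partial>m) + (\<Sum>y\<leftarrow>ys. norm y ^ 4))"
    using W unfolding quartic_growth_def by blast
  let ?d = "return borel 0 :: 'a measure"
  have "W2_bounded {?d}"
    using return_in_P_mom[of 0 2] by (auto simp: W2_bounded_def)
  then obtain D where D: "\<And>ys. length ys = p \<Longrightarrow> \<bar>V ?d ys\<bar> \<le> D * (1 + (\<Sum>y\<leftarrow>ys. norm y ^ 2))"
    using V unfolding quadratic_growth_def by blast
  have "\<bar>V m ys\<bar> \<le> (\<bar>D\<bar> * (1 + real p) + 2 * C) * (1 + (\<integral>y. norm y ^ 4 \<partial>m) + (\<Sum>y\<leftarrow>ys. norm y ^ 4))"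
    if m: "m \<in> P_mom 4" and ys: "length ys = p" for m ys
  proof -
    let ?M = "\<integral>y. norm y ^ 4 \<partial>m" and ?Y = "\<Sum>y\<leftarrow>ys. norm y ^ 4"
    interpret prob_space m using m by (simp add: P_mom_def)
    have sets: "sets m = sets borel" and int: "integrable m (\<lambda>y. norm y ^ 4)"
      using m by (auto simp: P_mom_def)
    have M: "0 \<le> ?M" and Y: "0 \<le> ?Y" by (auto intro!: integral_nonneg sum_list_nonneg)
    have P2: "?d \<in> P2" "m \<in> P2" using return_in_P_mom P_mom_mono[OF _ m] by auto
    have "norm y ^ 2 \<le> 1 + norm y ^ 4" for y :: 'a
    proof -
      \<comment> \<open>twice \<open>1 + u\<^sup>2 - u\<close> for \<open>u = norm y ^ 2\<close>\<close>
      have "0 \<le> (norm y ^ 2 - 1)\<^sup>2 + norm y ^ 2 * norm y ^ 2 + 1" by simp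
      then show ?thesis by (simp add: power2_eq_square algebra_simps power4_eq_xxxx)
    qed
    then have "(\<Sum>y\<leftarrow>ys. norm y ^ 2) \<le> (\<Sum>y\<leftarrow>ys. 1 + norm y ^ 4)"
      by (intro sum_list_mono)
    also have "\<dots> = real p + ?Y" using ys by (simp add: sum_list_addf sum_list_triv)
    finally have "1 + (\<Sum>y\<leftarrow>ys. norm y ^ 2) \<le> 1 + real p + ?Y" by simp
    also have "\<dots> \<le> 1 + real p + ?Y + (?M + real p * (?M + ?Y))" using M Y by simp
    also have "\<dots> = (1 + real p) * (1 + ?M + ?Y)" by (simp add: algebra_simps)
    finally have "1 + (\<Sum>y\<leftarrow>ys. norm y ^ 2) \<le> (1 + real p) * (1 + ?M + ?Y)" .
    then have "\<bar>V ?d ys\<bar> \<le> \<bar>D\<bar> * ((1 + real p) * (1 + ?M + ?Y))"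
      using D[OF ys] by (intro order_trans[OF D[OF ys]] mult_mono) (auto intro!: add_nonneg_nonneg sum_list_nonneg)
    moreover have "norm (V m ys - V ?d ys) \<le> 2 * C * (1 + ?M + ?Y)"
    proof (rule has_integral_unit_bound)
      show "((\<lambda>s. (\<integral>y. W (mix s ?d m) (ys @ [y]) \<partial>m) - (\<integral>y. W (mix s ?d m) (ys @ [y]) \<partial>?d))
           has_integral (V m ys - V ?d ys)) {0..1}"
        using VW P2 ys unfolding lin_deriv_def by blast
      show "0 \<le> 2 * C * (1 + ?M + ?Y)" using C(1) M Y by simp
      fix s :: real assume "s \<in> {0..1}"
      then have s: "0 \<le> s" "s \<le> 1" by auto
      let ?m = "mix s ?d m"
      have m4: "?m \<in> P_mom 4" and m2: "?m \<in> P2"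
        using mix_in_P_mom[OF s return_in_P_mom] m P2 by blast+
      have "(\<integral>y. norm y ^ 4 \<partial>?m) = s * ?M"
        using s sets int by (subst mix_integral(2)) (auto simp: integrable_return integral_return)
      also have "\<dots> \<le> ?M" using s M by (simp add: mult_left_le_one_le)
      finally have mM: "(\<integral>y. norm y ^ 4 \<partial>?m) \<le> ?M" .
      have bnd: "\<bar>W ?m (ys @ [y])\<bar> \<le> C * (1 + ?M + ?Y + norm y ^ 4)" for y
      proof -
        have "\<bar>W ?m (ys @ [y])\<bar> \<le> C * (1 + (\<integral>y. norm y ^ 4 \<partial>?m) + (\<Sum>y\<leftarrow>ys @ [y]. norm y ^ 4))"
          using m4 ys by (intro C(2)) auto
        also have "\<dots> \<le> C * (1 + ?M + ?Y + norm y ^ 4)"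
          using C(1) mM by (intro mult_left_mono) auto
        finally show ?thesis .
      qed
      have "norm (\<integral>y. W ?m (ys @ [y]) \<partial>m) \<le> (\<integral>y. norm (W ?m (ys @ [y])) \<partial>m)"
        by (rule integral_norm_bound)
      also have "\<dots> \<le> (\<integral>y. C * (1 + ?M + ?Y + norm y ^ 4) \<partial>m)"
        using bnd int C(1) M Y by (intro integral_mono') auto
      also have "\<dots> = C * (1 + ?M + ?Y + ?M)"
        using int by (simp add: prob_space)
      also have "\<dots> \<le> 2 * C * (1 + ?M + ?Y)"
        using C(1) M Y mult_nonneg_nonneg[of C ?Y] by (simp add: algebra_simps)
      finally have "norm (\<integral>y. W ?m (ys @ [y]) \<partial>m) \<le> 2 * C * (1 + ?M + ?Y)" .
      moreover have "(\<integral>y. W ?m (ys @ [y]) \<partial>?d) = W ?m (ys @ [0])"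
        using VW ys m2 unfolding lin_deriv_def
        by (intro integral_return continuous_P2_section_measurable) auto
      moreover have "W ?m (ys @ [0]) = 0"
        using VW ys m2 unfolding lin_deriv_def by auto
      ultimately show "norm ((\<integral>y. W ?m (ys @ [y]) \<partial>m) - (\<integral>y. W ?m (ys @ [y]) \<partial>?d)) \<le> 2 * C * (1 + ?M + ?Y)"
        by simp
    qed
    ultimately have "\<bar>V m ys\<bar> \<le> \<bar>D\<bar> * ((1 + real p) * (1 + ?M + ?Y)) + 2 * C * (1 + ?M + ?Y)"
      unfolding real_norm_def
      using abs_triangle_ineq[of "V m ys - V ?d ys" "V ?d ys"] by simp
    then show ?thesis
      using distrib_right[of "\<bar>D\<bar> * (1 + real p)" "2 * C" "1 + ?M + ?Y"] by (simp only: mult.assoc)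
  qed
  then show ?thesis
    unfolding quartic_growth_def using C(1)
    by (intro exI[of _ "\<bar>D\<bar> * (1 + real p) + 2 * C"]) auto
qed

text \<open>
  The bound on the fourth derivative is passed down two orders, to the second derivative, whose
  size controls the second differences of \<open>U\<close>.
\<close>

lemma class_ML_4_second_derivative:
  fixes U :: "'a::euclidean_space measure \<Rightarrow> real"
  assumes "U \<in> class_ML 4"
  obtains V0 V1 V2 C where "\<And>m. m \<in> P2 \<Longrightarrow> V0 m [] = U m" "lin_deriv 0 V0 V1" "lin_deriv 1 V1 V2" "C \<ge> 0"
    "\<And>m y y'. m \<in> P_mom 4 \<Longrightarrow> \<bar>V2 m [y, y']\<bar> \<le> C * (1 + (\<integral>y. norm y ^ 4 \<partial>m) + norm y ^ 4 + norm y' ^ 4)"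
proof -
  obtain V4 C where V4: "is_nth_lin_deriv 4 U V4"
    and C: "C > 0" "\<And>m ys. m \<in> P2 \<Longrightarrow> length ys = 4 \<Longrightarrow> \<bar>V4 m ys\<bar> \<le> C * (\<Sum>y\<leftarrow>ys. norm y ^ 4)"
    using assms unfolding class_ML_def by blast
  have four: "(4::nat) = Suc (Suc (Suc (Suc 0)))" by simp
  obtain V3 where V3: "is_nth_lin_deriv (Suc (Suc (Suc 0))) U V3" "lin_deriv (Suc (Suc (Suc 0))) V3 V4"
    using V4 unfolding four is_nth_lin_deriv.simps(2)[of "Suc (Suc (Suc 0))"] by blast
  obtain V2 where V2: "is_nth_lin_deriv (Suc (Suc 0)) U V2" "lin_deriv (Suc (Suc 0)) V2 V3"
    using V3(1) unfolding is_nth_lin_deriv.simps(2)[of "Suc (Suc 0)"] by blast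
  obtain V1 where V1: "is_nth_lin_deriv (Suc 0) U V1" "lin_deriv (Suc 0) V1 V2"
    using V2(1) unfolding is_nth_lin_deriv.simps(2)[of "Suc 0"] by blast
  obtain V0 where V0: "is_nth_lin_deriv 0 U V0" "lin_deriv 0 V0 V1"
    using V1(1) unfolding is_nth_lin_deriv.simps(2)[of 0] by blast
  have "quartic_growth (Suc (Suc (Suc (Suc 0)))) V4"
    unfolding quartic_growth_def
  proof (intro exI[of _ C] conjI ballI allI impI)
    fix m :: "'a measure" and ys :: "'a list" assume m: "m \<in> P_mom 4" and ys: "length ys = Suc (Suc (Suc (Suc 0)))"
    have "\<bar>V4 m ys\<bar> \<le> C * (\<Sum>y\<leftarrow>ys. norm y ^ 4)"
      using P_mom_mono[OF _ m] ys by (intro C(2)) auto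
    also have "\<dots> \<le> C * (1 + (\<integral>y. norm y ^ 4 \<partial>m) + (\<Sum>y\<leftarrow>ys. norm y ^ 4))"
      using C(1) by (intro mult_left_mono) auto
    finally show "\<bar>V4 m ys\<bar> \<le> C * (1 + (\<integral>y. norm y ^ 4 \<partial>m) + (\<Sum>y\<leftarrow>ys. norm y ^ 4))" .
  qed (use C in auto)
  from quartic_growth_lin_deriv[OF this V3(2)] V2(2) have "quartic_growth (Suc (Suc (Suc 0))) V3"
    by (simp add: lin_deriv_def)
  from quartic_growth_lin_deriv[OF this V2(2)] V1(2) have "quartic_growth (Suc (Suc 0)) V2"
    by (simp add: lin_deriv_def)
  then obtain C' where C': "C' \<ge> 0" "\<And>m ys. m \<in> P_mom 4 \<Longrightarrow> length ys = Suc (Suc 0) \<Longrightarrow>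
      \<bar>V2 m ys\<bar> \<le> C' * (1 + (\<integral>y. norm y ^ 4 \<partial>m) + (\<Sum>y\<leftarrow>ys. norm y ^ 4))"
    unfolding quartic_growth_def by blast
  have "\<bar>V2 m [y, y']\<bar> \<le> C' * (1 + (\<integral>y. norm y ^ 4 \<partial>m) + norm y ^ 4 + norm y' ^ 4)"
    if "m \<in> P_mom 4" for m y y'
    using C'(2)[OF that, of "[y, y']"] by (simp add: add.assoc)
  with V0 V1(2) C'(1) show thesis by (intro that[of V0 V1 V2 C']) simp_all
qed

text \<open>
  \<open>U (empirical J x') - U (empirical J x)\<close> is an average over \<open>i\<close> and over the segment
  of \<open>V1 m [x' i] - V1 m [x i]\<close>. When the points move little, every \<open>m\<close> on the segment
  stays \<open>W2\<close>-close to \<open>empirical J x\<close>, so both terms are close to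
  \<open>V1 (empirical J x) [x i]\<close>. This continuity is what makes \<open>U\<close> of a random
  empirical measure a random variable.
\<close>

lemma continuous_empirical:
  fixes U :: "'a::euclidean_space measure \<Rightarrow> real"
  assumes J: "finite J" "J \<noteq> {}" and V0: "\<And>m. m \<in> P2 \<Longrightarrow> V0 m [] = U m" and V: "lin_deriv 0 V0 V1"
  shows "continuous_on UNIV (\<lambda>x. U (empirical J x))"
  unfolding continuous_on_def
proof
  fix x :: "'b \<Rightarrow> 'a"
  let ?E = "empirical J"
  have P2: "?E x \<in> P2" for x :: "'b \<Rightarrow> 'a" using J by (rule empirical_in_P_mom)
  have cont: "continuous_P2 1 V1" using V by (simp add: lin_deriv_def)
  show "((\<lambda>x. U (?E x)) \<longlongrightarrow> U (?E x)) (at x)"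
    unfolding tendsto_iff
  proof (intro allI impI)
    fix e :: real assume "0 < e"
    then have "0 < e / 4" by simp
    have "\<exists>d>0. \<forall>m\<in>P2. \<forall>y. W2 (?E x) m < d \<longrightarrow> dist (x i) y < d \<longrightarrow>
        \<bar>V1 m [y] - V1 (?E x) [x i]\<bar> < e / 4" for i
    proof -
      obtain d where "d > 0" and d: "\<forall>m\<in>P2. \<forall>ys. length ys = 1 \<longrightarrow> W2 (?E x) m < d \<longrightarrow>
          (\<forall>k<1. dist ([x i] ! k) (ys ! k) < d) \<longrightarrow> \<bar>V1 m ys - V1 (?E x) [x i]\<bar> < e / 4"
        using cont[unfolded continuous_P2_def, rule_format, OF P2[of x], of "[x i]" "e / 4"] \<open>0 < e / 4\<close> by auto
      have "\<bar>V1 m [y] - V1 (?E x) [x i]\<bar> < e / 4" if "m \<in> P2" "W2 (?E x) m < d" "dist (x i) y < d" for m y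
        using d[rule_format, of m "[y]"] that by simp
      with \<open>d > 0\<close> show ?thesis by blast
    qed
    then obtain d where d: "\<And>i. i \<in> J \<Longrightarrow> d i > 0"
      "\<And>i m y. \<lbrakk>i \<in> J; m \<in> P2; W2 (?E x) m < d i; dist (x i) y < d i\<rbrakk> \<Longrightarrow>
        \<bar>V1 m [y] - V1 (?E x) [x i]\<bar> < e / 4"
      by metis
    define r where "r = Min (d ` J) / 2"
    have r: "r > 0" "\<And>i. i \<in> J \<Longrightarrow> r < d i"
    proof -
      have "Min (d ` J) > 0" using J d(1) by auto
      then show "r > 0" by (simp add: r_def)
      fix i assume "i \<in> J"
      then have "Min (d ` J) \<le> d i" using J by auto
      then show "r < d i" using \<open>Min (d ` J) > 0\<close> by (simp add: r_def)
    qed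
    have close: "dist (U (?E x')) (U (?E x)) < e" if x': "\<forall>i\<in>J. dist (x' i) (x i) < r" for x'
    proof -
      have x'': "dist (x i) (x' i) \<le> r" if "i \<in> J" for i
        using x' that by (metis dist_commute less_imp_le)
      let ?n = "real (card J)"
      have n: "?n > 0" using J by (simp add: card_gt_0_iff)
      have "norm (V0 (?E x') [] - V0 (?E x) []) \<le> e / 2"
      proof (rule has_integral_unit_bound)
        show "((\<lambda>s. (\<integral>y. V1 (mix s (?E x) (?E x')) ([] @ [y]) \<partial>?E x') - (\<integral>y. V1 (mix s (?E x) (?E x')) ([] @ [y]) \<partial>?E x))
           has_integral (V0 (?E x') [] - V0 (?E x) [])) {0..1}"
          using V P2[of x] P2[of x'] unfolding lin_deriv_def by blast
        show "0 \<le> e / 2" using \<open>0 < e\<close> by simp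
        fix s :: real assume "s \<in> {0..1}"
        then have s: "0 \<le> s" "s \<le> 1" by auto
        let ?m = "mix s (?E x) (?E x')"
        have m: "?m \<in> P2" using s P2 by (intro mix_in_P_mom)
        have W: "W2 (?E x) ?m \<le> r" using J s x'' by (intro W2_empirical_mix_le)
        have meas: "(\<lambda>y. V1 ?m ([] @ [y])) \<in> borel_measurable borel"
          using cont m by (intro continuous_P2_section_measurable) auto
        have emp: "(\<integral>y. V1 ?m ([] @ [y]) \<partial>?E z) = (\<Sum>i\<in>J. 1 / ?n * V1 ?m [z i])" for z
          unfolding empirical_eq_point_masses
          using point_masses_integral(2)[OF J(1) uniform_weights[OF J]] meas
          by (simp add: empirical_eq_point_masses)
        have "norm ((\<Sum>i\<in>J. 1 / ?n * V1 ?m [x' i]) - (\<Sum>i\<in>J. 1 / ?n * V1 ?m [x i]))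
            = norm (\<Sum>i\<in>J. 1 / ?n * (V1 ?m [x' i] - V1 ?m [x i]))"
          by (simp add: right_diff_distrib sum_subtractf diff_divide_distrib)
        also have "\<dots> \<le> (\<Sum>i\<in>J. 1 / ?n * (e / 2))"
        proof (rule sum_norm_le)
          fix i assume i: "i \<in> J"
          have "\<bar>V1 ?m [x' i] - V1 (?E x) [x i]\<bar> < e / 4" "\<bar>V1 ?m [x i] - V1 (?E x) [x i]\<bar> < e / 4"
            using W r(2)[OF i] d(1)[OF i] x''[OF i] by (intro d(2)[OF i m]; simp)+
          then have "\<bar>V1 ?m [x' i] - V1 ?m [x i]\<bar> \<le> e / 2" by linarith
          then show "norm (1 / ?n * (V1 ?m [x' i] - V1 ?m [x i])) \<le> 1 / ?n * (e / 2)"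
            unfolding real_norm_def abs_mult using n by (intro mult_mono) simp_all
        qed
        also have "\<dots> = e / 2" using n by simp
        finally show "norm ((\<integral>y. V1 ?m ([] @ [y]) \<partial>?E x') - (\<integral>y. V1 ?m ([] @ [y]) \<partial>?E x)) \<le> e / 2"
          unfolding emp .
      qed
      then show ?thesis using P2 V0 \<open>0 < e\<close> by (simp add: dist_real_def)
    qed
    have coord: "((\<lambda>y :: 'b \<Rightarrow> 'a. y i) \<longlongrightarrow> x i) (at x)" for i
    proof -
      have "continuous_on UNIV (\<lambda>y :: 'b \<Rightarrow> 'a. y i)" by (rule continuous_on_product_coordinates)
      then show ?thesis by (simp add: continuous_on_def)
    qed
    have "\<forall>\<^sub>F x' in at x. \<forall>i\<in>J. dist (x' i) (x i) < r"
      using J(1) coord r(1) unfolding tendsto_iff by (intro eventually_ball_finite) auto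
    then show "\<forall>\<^sub>F x' in at x. dist (U (?E x')) (U (?E x)) < e"
      by (rule eventually_mono) (rule close)
  qed
qed

section \<open>The antithetic difference of a fixed sample\<close>

lemma sum_1_to_double:
  fixes f :: "nat \<Rightarrow> 'b::comm_monoid_add"
  shows "(\<Sum>k=1..2*N. f k) = (\<Sum>i=1..N. f i + f (N + i))"
proof -
  have "{1..2*N} = {1..N} \<union> {1+N..N+N}" by auto
  then have "(\<Sum>k=1..2*N. f k) = (\<Sum>i=1..N. f i) + (\<Sum>k=1+N..N+N. f k)"
    by (simp add: sum.union_disjoint)
  also have "(\<Sum>k=1+N..N+N. f k) = (\<Sum>i=1..N. f (N + i))"
    using sum.shift_bounds_cl_nat_ivl[of f 1 N N] by (simp add: add.commute)
  finally show ?thesis by (simp add: sum.distrib)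
qed

text \<open>
  The parameter \<open>t i\<close> moves mass between the points \<open>i\<close> and \<open>N + i\<close>.
  At \<open>t = 0\<close> all points have equal mass, at \<open>t = 1\<close> only the first \<open>N\<close> points
  have mass and at \<open>t = -1\<close> only the last \<open>N\<close>: these are the three empirical measures
  of the theorem.
\<close>

definition pair_weights :: "nat \<Rightarrow> (nat \<Rightarrow> real) \<Rightarrow> nat \<Rightarrow> real" where
  "pair_weights N t k = (if k \<le> N then 1 + t k else 1 - t (k - N)) / (2 * real N)"

definition pair_direction :: "nat \<Rightarrow> nat \<Rightarrow> nat \<Rightarrow> real" where
  "pair_direction N i k = (if k = i then 1 else if k = N + i then -1 else 0)"

lemma pair_weights_in_weights:
  assumes "N \<ge> 1" and t: "\<forall>i\<in>{1..N}. \<bar>t i\<bar> \<le> 1"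
  shows "pair_weights N t \<in> weights {1..2*N} (1 / real N)"
  unfolding weights_def mem_Collect_eq
proof (intro conjI ballI)
  fix k assume k: "k \<in> {1..2*N}"
  have "(if k \<le> N then k else k - N) \<in> {1..N}" using k by auto
  with t have "\<bar>t (if k \<le> N then k else k - N)\<bar> \<le> 1" by blast
  then show "0 \<le> pair_weights N t k" "pair_weights N t k \<le> 1 / real N"
    using assms(1) by (auto simp: pair_weights_def field_simps split: if_splits)
next
  have "sum (pair_weights N t) {1..2*N} = (\<Sum>i=1..N. pair_weights N t i + pair_weights N t (N + i))"
    by (rule sum_1_to_double)
  also have "\<dots> = (\<Sum>i=1..N. 1 / real N)"
    by (intro sum.cong refl) (simp add: pair_weights_def field_simps)
  finally show "sum (pair_weights N t) {1..2*N} = 1" using assms(1) by simp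
qed

lemma pair_weights_upd:
  assumes "i \<in> {1..N}"
  shows "pair_weights N (t(i := u + v)) = (\<lambda>k. pair_weights N (t(i := u)) k + v / (2 * real N) * pair_direction N i k)"
  using assms by (auto simp: fun_eq_iff pair_weights_def pair_direction_def add_divide_distrib diff_divide_distrib)

lemma sum_pair_direction:
  assumes "i \<in> {1..N}"
  shows "(\<Sum>k=1..2*N. \<bar>a * pair_direction N i k\<bar> * f k) = \<bar>a\<bar> * (f i + f (N + i))"
proof -
  have "(\<Sum>k=1..2*N. \<bar>a * pair_direction N i k\<bar> * f k)
      = (\<Sum>k=1..N. if k = i then \<bar>a\<bar> * (f k + f (N + k)) else 0)"
    unfolding sum_1_to_double
    by (intro sum.cong refl) (use assms in \<open>auto simp: pair_direction_def algebra_simps\<close>)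
  then show ?thesis using assms by simp
qed

lemma sum_sq_le_four: "(a + b + c + d)\<^sup>2 \<le> 4 * (a\<^sup>2 + b\<^sup>2 + c\<^sup>2 + d\<^sup>2)" for a b c d :: real
proof -
  have "0 \<le> (a - b)\<^sup>2 + (a - c)\<^sup>2 + (a - d)\<^sup>2 + (b - c)\<^sup>2 + (b - d)\<^sup>2 + (c - d)\<^sup>2" by simp
  then show ?thesis by (simp add: power2_eq_square algebra_simps)
qed

text \<open>
  Changing one \<open>t i\<close> by \<open>v\<close> moves mass \<open>v / (2 N)\<close>, so a second difference carries
  the factor \<open>1 / N\<^sup>2\<close>. Since no coefficient exceeds \<open>1 / N\<close>, the fourth moments that enter the
  bound on \<open>V2\<close> are at most the average of \<open>q\<close>. The two claims are the hypotheses of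
  the estimate \<open>cube_antithetic\<close>.
\<close>

lemma pair_second_differences:
  fixes U :: "'a::euclidean_space measure \<Rightarrow> real" and x :: "nat \<Rightarrow> 'a"
  assumes V0: "\<And>m. m \<in> P2 \<Longrightarrow> V0 m [] = U m" and V: "lin_deriv 0 V0 V1" "lin_deriv 1 V1 V2" and C: "C \<ge> 0"
    and V2: "\<And>m y y'. m \<in> P_mom 4 \<Longrightarrow>
      \<bar>V2 m [y, y']\<bar> \<le> C * (1 + (\<integral>y. norm y ^ 4 \<partial>m) + norm y ^ 4 + norm y' ^ 4)"
    and N: "N \<ge> 1"
  defines "\<phi> \<equiv> \<lambda>t. U (point_masses {1..2*N} x (pair_weights N t))"
    and "q \<equiv> \<lambda>i. norm (x i) ^ 4 + norm (x (N + i)) ^ 4"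
  defines "A \<equiv> \<lambda>i j. C / (real N)\<^sup>2 * (1 + (\<Sum>k=1..N. q k) / real N + q i + q j)"
  shows "\<And>t i j. \<lbrakk>\<forall>k\<in>{1..N}. \<bar>t k\<bar> \<le> 1; i \<in> {1..N}; j \<in> {1..N}; i \<noteq> j\<rbrakk> \<Longrightarrow>
      \<bar>\<phi> (t(i := 1, j := 1)) - \<phi> (t(i := 1, j := -1)) - \<phi> (t(i := -1, j := 1)) + \<phi> (t(i := -1, j := -1))\<bar>
        \<le> 4 * A i j"
    and "\<And>t i. \<lbrakk>\<forall>k\<in>{1..N}. \<bar>t k\<bar> \<le> 1; i \<in> {1..N}\<rbrakk> \<Longrightarrow>
      \<bar>\<phi> (t(i := 1)) - 2 * \<phi> (t(i := 0)) + \<phi> (t(i := -1))\<bar> \<le> A i i"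
proof -
  let ?J = "{1..2*N}" and ?P = "point_masses {1..2*N} x" and ?w = "pair_weights N"
  let ?d = "pair_direction N"
  let ?Q = "(\<Sum>k=1..N. q k) / real N"
  define K where "K k l = C * (1 + ?Q + norm (x k) ^ 4 + norm (x l) ^ 4)" for k l
  have q0: "0 \<le> q i" for i by (simp add: q_def)
  have K: "\<bar>V2 (?P c) [x k, x l]\<bar> \<le> K k l" if c: "c \<in> weights ?J (1 / real N)" for c k l
  proof -
    have P4: "?P c \<in> P_mom 4" using c by (intro point_masses_in_P_mom) auto
    have "(\<integral>y. norm y ^ 4 \<partial>?P c) = (\<Sum>k=1..2*N. c k * norm (x k) ^ 4)"
      using c by (intro point_masses_integral(2)) auto
    also have "\<dots> \<le> (\<Sum>k=1..2*N. 1 / real N * norm (x k) ^ 4)"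
      using c by (intro sum_mono mult_right_mono) (auto simp: weights_def)
    also have "\<dots> = ?Q"
      unfolding sum_1_to_double q_def by (simp add: sum_divide_distrib add_divide_distrib)
    finally show ?thesis
      unfolding K_def using C by (intro order_trans[OF V2[OF P4]] mult_left_mono) auto
  qed
  \<comment> \<open>The four points span a rectangle of side \<open>v\<close> in the coordinates \<open>i\<close> and \<open>j\<close>;
    for \<open>i = j\<close> it degenerates to a segment of length \<open>2 v\<close> whose midpoint counts twice.\<close>
  have rect: "\<bar>\<phi> t11 - \<phi> t10 - \<phi> t01 + \<phi> t00\<bar> \<le> v\<^sup>2 * A i j"
    if ij: "i \<in> {1..N}" "j \<in> {1..N}" and v: "v \<ge> 0"
      and cube: "\<forall>k\<in>{1..N}. \<bar>t00 k\<bar> \<le> 1" "\<forall>k\<in>{1..N}. \<bar>t10 k\<bar> \<le> 1"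
        "\<forall>k\<in>{1..N}. \<bar>t01 k\<bar> \<le> 1" "\<forall>k\<in>{1..N}. \<bar>t11 k\<bar> \<le> 1"
      and w: "?w t10 = (\<lambda>k. ?w t00 k + v / (2 * real N) * ?d i k)"
        "?w t01 = (\<lambda>k. ?w t00 k + v / (2 * real N) * ?d j k)"
        "?w t11 = (\<lambda>k. ?w t00 k + v / (2 * real N) * ?d i k + v / (2 * real N) * ?d j k)"
    for i j v t00 t10 t01 t11
  proof -
    let ?a = "\<lambda>k. v / (2 * real N) * ?d i k" and ?b = "\<lambda>k. v / (2 * real N) * ?d j k"
    have in_w: "?w t \<in> weights ?J (1 / real N)" if "\<forall>k\<in>{1..N}. \<bar>t k\<bar> \<le> 1" for t
      using N that by (rule pair_weights_in_weights)
    have \<phi>: "\<phi> t = V0 (?P (?w t)) []" if "\<forall>k\<in>{1..N}. \<bar>t k\<bar> \<le> 1" for t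
      unfolding \<phi>_def using in_w[OF that] by (intro V0[symmetric] point_masses_in_P_mom) auto
    have "\<bar>\<phi> t11 - \<phi> t10 - \<phi> t01 + \<phi> t00\<bar> \<le> (\<Sum>k\<in>?J. \<Sum>l\<in>?J. \<bar>?b k\<bar> * \<bar>?a l\<bar> * K k l)"
      unfolding \<phi>[OF cube(1)] \<phi>[OF cube(2)] \<phi>[OF cube(3)] \<phi>[OF cube(4)] w
      by (rule second_difference_bound[OF V _ _ _ _ _ K, where \<beta> = "1 / real N"])
        (use in_w[OF cube(1)] in_w[OF cube(2)] in_w[OF cube(3)] in_w[OF cube(4)] w in auto)
    also have "\<dots> = (\<Sum>k\<in>?J. \<bar>?b k\<bar> * (\<Sum>l\<in>?J. \<bar>?a l\<bar> * K k l))"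
      by (simp only: sum_distrib_left mult.assoc)
    also have "\<dots> = (v / (2 * real N))\<^sup>2 * (K j i + K j (N + i) + (K (N + j) i + K (N + j) (N + i)))"
      unfolding sum_pair_direction[OF ij(1)] sum_pair_direction[OF ij(2)]
      using v by (simp add: power2_eq_square algebra_simps add_divide_distrib)
    also have "K j i + K j (N + i) + (K (N + j) i + K (N + j) (N + i)) = C * (4 + 4 * ?Q + 2 * q i + 2 * q j)"
      by (simp add: K_def q_def algebra_simps)
    also have "\<dots> \<le> C * (4 * (1 + ?Q + q i + q j))"
      using C q0[of i] q0[of j] by (intro mult_left_mono) auto
    also have "(v / (2 * real N))\<^sup>2 * (C * (4 * (1 + ?Q + q i + q j))) = v\<^sup>2 * A i j"
    proof -
      have "(v / (2 * real N))\<^sup>2 * (C * (4 * y)) = v\<^sup>2 * (C / (real N)\<^sup>2 * y)" for y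
        by (simp add: power_divide power_mult_distrib)
      then show ?thesis by (simp only: A_def)
    qed
    finally show ?thesis by (simp add: mult_left_mono)
  qed
  show "\<bar>\<phi> (t(i := 1, j := 1)) - \<phi> (t(i := 1, j := -1)) - \<phi> (t(i := -1, j := 1)) + \<phi> (t(i := -1, j := -1))\<bar>
      \<le> 4 * A i j" if t: "\<forall>k\<in>{1..N}. \<bar>t k\<bar> \<le> 1" and ij: "i \<in> {1..N}" "j \<in> {1..N}" "i \<noteq> j" for t i j
  proof -
    have i: "?w (s(i := 1)) = (\<lambda>k. ?w (s(i := -1)) k + 2 / (2 * real N) * ?d i k)" for s
      using pair_weights_upd[OF ij(1), of s "-1" 2] by simp
    have j: "?w (s(j := 1)) = (\<lambda>k. ?w (s(j := -1)) k + 2 / (2 * real N) * ?d j k)" for s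
      using pair_weights_upd[OF ij(2), of s "-1" 2] by simp
    have "\<bar>\<phi> (t(i := 1, j := 1)) - \<phi> (t(i := 1, j := -1)) - \<phi> (t(i := -1, j := 1)) + \<phi> (t(i := -1, j := -1))\<bar>
        \<le> 2\<^sup>2 * A i j"
    proof (rule rect[OF ij(1,2)])
      have "t(i := 1, j := -1) = t(j := -1, i := 1)" "t(i := -1, j := -1) = t(j := -1, i := -1)"
        using ij(3) by (auto simp: fun_eq_iff)
      then show i': "?w (t(i := 1, j := -1)) = (\<lambda>k. ?w (t(i := -1, j := -1)) k + 2 / (2 * real N) * ?d i k)"
        using i[of "t(j := -1)"] by simp
      show "?w (t(i := -1, j := 1)) = (\<lambda>k. ?w (t(i := -1, j := -1)) k + 2 / (2 * real N) * ?d j k)"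
        by (rule j)
      show "?w (t(i := 1, j := 1)) =
          (\<lambda>k. ?w (t(i := -1, j := -1)) k + 2 / (2 * real N) * ?d i k + 2 / (2 * real N) * ?d j k)"
        using j[of "t(i := 1)"] i' by simp
    qed (use t in auto)
    then show ?thesis by simp
  qed
  show "\<bar>\<phi> (t(i := 1)) - 2 * \<phi> (t(i := 0)) + \<phi> (t(i := -1))\<bar> \<le> A i i"
    if t: "\<forall>k\<in>{1..N}. \<bar>t k\<bar> \<le> 1" and i: "i \<in> {1..N}" for t i
  proof -
    have up: "?w (t(i := 0)) = (\<lambda>k. ?w (t(i := -1)) k + 1 / (2 * real N) * ?d i k)"
      "?w (t(i := 1)) = (\<lambda>k. ?w (t(i := 0)) k + 1 / (2 * real N) * ?d i k)"
      using pair_weights_upd[OF i, of t "-1" 1] pair_weights_upd[OF i, of t 0 1] by simp_all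
    have "\<bar>\<phi> (t(i := 1)) - \<phi> (t(i := 0)) - \<phi> (t(i := 0)) + \<phi> (t(i := -1))\<bar> \<le> 1\<^sup>2 * A i i"
      by (rule rect[OF i i _ _ _ _ _ up(1) up(1)]) (use t up in auto)
    then show ?thesis by simp
  qed
qed

text \<open>
  All \<open>N\<^sup>2\<close> coefficients are of order \<open>1 / N\<^sup>2\<close>, so the squared sum of the \<open>N\<close>
  diagonal ones and the sum of the squares of all of them are both of order \<open>1 / N\<^sup>2\<close>. The
  squared mean of \<open>q\<close> is absorbed by the mean of the squares.
\<close>

lemma antithetic_constant:
  fixes q :: "nat \<Rightarrow> real" and C :: real
  assumes N: "N \<ge> 1"
  defines "A \<equiv> \<lambda>i j. C / (real N)\<^sup>2 * (1 + (\<Sum>k=1..N. q k) / real N + q i + q j)"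
  shows "(\<Sum>i=1..N. A i i)\<^sup>2 / 4 + (\<Sum>i=1..N. \<Sum>j=1..N. (A i j)\<^sup>2)
    \<le> 17 * C\<^sup>2 / (real N)\<^sup>2 * (1 + (\<Sum>k=1..N. (q k)\<^sup>2) / real N)"
proof -
  let ?n = "real N"
  define Q where "Q = (\<Sum>k=1..N. q k) / ?n"
  define R where "R = (\<Sum>k=1..N. (q k)\<^sup>2) / ?n"
  have n: "?n > 0" using N by simp
  have sq: "(\<Sum>k=1..N. q k) = ?n * Q" "(\<Sum>k=1..N. (q k)\<^sup>2) = ?n * R"
    using n by (simp_all add: Q_def R_def)
  \<comment> \<open>Expanding the empirical variance of \<open>q\<close> gives \<open>Q\<^sup>2 \<le> R\<close>.\<close>
  have "0 \<le> (\<Sum>k=1..N. (q k - Q)\<^sup>2)" by (intro sum_nonneg) simp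
  also have "(\<Sum>k=1..N. (q k - Q)\<^sup>2) = (\<Sum>k=1..N. (q k)\<^sup>2 - 2 * Q * q k + Q\<^sup>2)"
    by (intro sum.cong refl) (simp add: power2_eq_square algebra_simps)
  also have "\<dots> = ?n * R - 2 * Q * (?n * Q) + ?n * Q\<^sup>2"
    by (simp only: sum.distrib sum_subtractf sum_distrib_left[symmetric] sq) simp
  also have "\<dots> = ?n * (R - Q\<^sup>2)" by (simp add: power2_eq_square algebra_simps)
  finally have QR: "Q\<^sup>2 \<le> R" using n by (simp add: zero_le_mult_iff)
  have A: "A i j = C / ?n\<^sup>2 * (1 + Q + q i + q j)" for i j by (simp add: A_def Q_def)
  have "(\<Sum>i=1..N. A i i) = C / ?n\<^sup>2 * (?n * (1 + Q) + 2 * (?n * Q))"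
    unfolding A sum_distrib_left[symmetric] sq(1)[symmetric] by (simp add: sum.distrib sum_distrib_left)
  also have "\<dots> = C / ?n * (1 + 3 * Q)"
    using n by (simp add: power2_eq_square field_simps)
  finally have "(\<Sum>i=1..N. A i i)\<^sup>2 / 4 = C\<^sup>2 / ?n\<^sup>2 * ((1 + 3 * Q)\<^sup>2 / 4)"
    by (simp add: power_mult_distrib power_divide)
  also have "\<dots> \<le> C\<^sup>2 / ?n\<^sup>2 * (1 + 5 * R)"
  proof (intro mult_left_mono)
    \<comment> \<open>\<open>(1 + u)\<^sup>2 \<le> 2 + 2 u\<^sup>2\<close> for \<open>u = 3 Q\<close>\<close>
    have "0 \<le> (1 - 3 * Q)\<^sup>2" by simp
    then have "(1 + 3 * Q)\<^sup>2 \<le> 2 + 18 * Q\<^sup>2" by (simp add: power2_eq_square algebra_simps)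
    moreover have "0 \<le> Q\<^sup>2" by simp
    ultimately show "(1 + 3 * Q)\<^sup>2 / 4 \<le> 1 + 5 * R" using QR by linarith
  qed simp
  finally have bias: "(\<Sum>i=1..N. A i i)\<^sup>2 / 4 \<le> C\<^sup>2 / ?n\<^sup>2 * (1 + 5 * R)" .
  have "(\<Sum>i=1..N. \<Sum>j=1..N. (A i j)\<^sup>2)
      \<le> (\<Sum>i=1..N. \<Sum>j=1..N. (C / ?n\<^sup>2)\<^sup>2 * (4 * ((1\<^sup>2 + Q\<^sup>2 + (q i)\<^sup>2) + (q j)\<^sup>2)))"
    unfolding A power_mult_distrib
    by (intro sum_mono mult_left_mono order_trans[OF sum_sq_le_four]) auto
  also have "\<dots> = (C / ?n\<^sup>2)\<^sup>2 * (4 * (\<Sum>i=1..N. \<Sum>j=1..N. (1\<^sup>2 + Q\<^sup>2 + (q i)\<^sup>2) + (q j)\<^sup>2))"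
    by (simp only: sum_distrib_left)
  also have "(\<Sum>i=1..N. \<Sum>j=1..N. (1\<^sup>2 + Q\<^sup>2 + (q i)\<^sup>2) + (q j)\<^sup>2) = ?n\<^sup>2 * (1 + Q\<^sup>2 + 2 * R)"
    by (simp add: sum.distrib sq del: One_nat_def flip: sum_distrib_left)
      (simp add: power2_eq_square algebra_simps)
  also have "(C / ?n\<^sup>2)\<^sup>2 * (4 * (?n\<^sup>2 * (1 + Q\<^sup>2 + 2 * R))) = C\<^sup>2 / ?n\<^sup>2 * (4 * (1 + Q\<^sup>2 + 2 * R))"
    using n by (simp add: power_divide power2_eq_square)
  also have "\<dots> \<le> C\<^sup>2 / ?n\<^sup>2 * (4 + 12 * R)"
    using QR by (intro mult_left_mono) auto
  finally have "(\<Sum>i=1..N. \<Sum>j=1..N. (A i j)\<^sup>2) \<le> C\<^sup>2 / ?n\<^sup>2 * (4 + 12 * R)" .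
  with bias have "(\<Sum>i=1..N. A i i)\<^sup>2 / 4 + (\<Sum>i=1..N. \<Sum>j=1..N. (A i j)\<^sup>2)
      \<le> C\<^sup>2 / ?n\<^sup>2 * (1 + 5 * R) + C\<^sup>2 / ?n\<^sup>2 * (4 + 12 * R)" by (rule add_mono)
  also have "\<dots> = C\<^sup>2 / ?n\<^sup>2 * (5 + 17 * R)" by (simp only: distrib_left[symmetric]) simp
  also have "\<dots> \<le> C\<^sup>2 / ?n\<^sup>2 * (17 * (1 + R))" by (intro mult_left_mono) auto
  finally show ?thesis by (simp add: R_def mult.assoc mult.commute)
qed

definition antithetic_difference :: "('a::euclidean_space measure \<Rightarrow> real) \<Rightarrow> nat \<Rightarrow> (nat \<Rightarrow> 'a) \<Rightarrow> real" where
  "antithetic_difference U N x =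
     U (empirical {1..2*N} x) - 1/2 * (U (empirical {1..N} x) + U (empirical {N+1..2*N} x))"

text \<open>
  Exchanging the points \<open>i\<close> and \<open>N + i\<close> for every \<open>i \<in> S\<close>, as a permutation of the
  indices \<open>1, ..., 2 N\<close>.
\<close>

definition swap_pairs :: "nat \<Rightarrow> nat set \<Rightarrow> nat \<Rightarrow> nat" where
  "swap_pairs N S k = (if k \<in> S then N + k else if N < k \<and> k - N \<in> S then k - N else k)"

lemma swap_pairs_first: "i \<in> {1..N} \<Longrightarrow> swap_pairs N S i = (if i \<in> S then N + i else i)"
  by (auto simp: swap_pairs_def)

lemma swap_pairs_second:
  "S \<subseteq> {1..N} \<Longrightarrow> i \<in> {1..N} \<Longrightarrow> swap_pairs N S (N + i) = (if i \<in> S then i else N + i)"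
  by (auto simp: swap_pairs_def)

lemma bij_swap_pairs:
  assumes "S \<subseteq> {1..N}"
  shows "bij_betw (swap_pairs N S) {1..2*N} {1..2*N}"
  by (rule bij_betwI[where g = "swap_pairs N S"]) (use assms in \<open>auto simp: swap_pairs_def subset_iff\<close>)

text \<open>
  Swapping the pairs in \<open>S\<close> leaves the full sample unchanged and turns the first half into
  the half described by the sign vector that is \<open>-1\<close> on \<open>S\<close> and \<open>+1\<close> elsewhere.
  Thus the swapped samples run through all sign vectors of the cube.
\<close>

lemma antithetic_difference_swap:
  fixes x :: "nat \<Rightarrow> 'a::euclidean_space"
  assumes N: "N \<ge> 1" and S: "S \<subseteq> {1..N}"
  defines "P \<equiv> \<lambda>t. point_masses {1..2*N} x (pair_weights N t)"
  shows "antithetic_difference U N (\<lambda>k. x (swap_pairs N S k)) =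
    U (P (\<lambda>_. 0)) - (U (P (signs S)) + U (P (signs ({1..N} - S)))) / 2"
proof -
  let ?y = "\<lambda>k. x (swap_pairs N S k)"
  have P: "emeasure (P t) B = (\<Sum>i=1..N. ennreal ((1 + t i) / (2 * real N)) * indicator B (x i)
      + ennreal ((1 - t i) / (2 * real N)) * indicator B (x (N + i)))" if "B \<in> sets borel" for t B
    unfolding P_def emeasure_point_masses[OF that] sum_1_to_double
    by (intro sum.cong refl) (simp add: pair_weights_def)
  have half: "1 / real (card {1..2*N}) = 1 / (2 * real N)" by simp
  have "empirical {1..2*N} ?y = P (\<lambda>_. 0)"
  proof (rule measure_eqI)
    fix B assume "B \<in> sets (empirical {1..2*N} ?y)"
    then have B: "B \<in> sets borel" by simp
    show "emeasure (empirical {1..2*N} ?y) B = emeasure (P (\<lambda>_. 0)) B"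
      unfolding P[OF B] emeasure_empirical[OF B] half sum_1_to_double
    proof (intro sum.cong refl)
      fix i assume "i \<in> {1..N}"
      note sw = swap_pairs_first[OF this] swap_pairs_second[OF S this]
      show "ennreal (1 / (2 * real N)) * indicator B (x (swap_pairs N S i))
          + ennreal (1 / (2 * real N)) * indicator B (x (swap_pairs N S (N + i)))
        = ennreal ((1 + 0) / (2 * real N)) * indicator B (x i)
          + ennreal ((1 - 0) / (2 * real N)) * indicator B (x (N + i))"
        unfolding sw by (cases "i \<in> S") (simp_all only: if_True if_False add_0_right diff_0_right add.commute)
    qed
  qed (simp add: P_def)
  moreover have "empirical {1..N} ?y = P (signs ({1..N} - S))"
  proof (rule measure_eqI)
    fix B assume "B \<in> sets (empirical {1..N} ?y)"
    then have B: "B \<in> sets borel" by simp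
    show "emeasure (empirical {1..N} ?y) B = emeasure (P (signs ({1..N} - S))) B"
      unfolding P[OF B] emeasure_empirical[OF B]
      by (intro sum.cong refl) (simp add: swap_pairs_first signs_def)
  qed (simp add: P_def)
  moreover have "empirical {N+1..2*N} ?y = P (signs S)"
  proof (rule measure_eqI)
    fix B assume "B \<in> sets (empirical {N+1..2*N} ?y)"
    then have B: "B \<in> sets borel" by simp
    have shift: "(\<Sum>k=N+1..2*N. f k) = (\<Sum>i=1..N. f (N + i))" for f :: "nat \<Rightarrow> ennreal"
      using sum.shift_bounds_cl_nat_ivl[of f 1 N N] by (simp add: add.commute mult_2)
    show "emeasure (empirical {N+1..2*N} ?y) B = emeasure (P (signs S)) B"
      unfolding P[OF B] emeasure_empirical[OF B] shift
      by (intro sum.cong refl) (simp add: swap_pairs_second[OF S] signs_def)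
  qed (simp add: P_def)
  ultimately show ?thesis
    by (simp add: antithetic_difference_def add.commute)
qed

text \<open>
  The rate \<open>1 / N\<^sup>2\<close> holds for every fixed sample, once the square is averaged over the
  \<open>2 ^ N\<close> ways of splitting the given pairs between the two halves; no probability is involved
  yet. For one fixed splitting it fails in general, because the \<open>N\<^sup>2\<close> mixed second differences may then
  add up; in the mean square over all splittings they behave like orthogonal terms.
\<close>

lemma cube_avg_antithetic_difference_le:
  fixes U :: "'a::euclidean_space measure \<Rightarrow> real"
  assumes V0: "\<And>m. m \<in> P2 \<Longrightarrow> V0 m [] = U m" and V: "lin_deriv 0 V0 V1" "lin_deriv 1 V1 V2" and C: "C \<ge> 0"
    and V2: "\<And>m y y'. m \<in> P_mom 4 \<Longrightarrow>
      \<bar>V2 m [y, y']\<bar> \<le> C * (1 + (\<integral>y. norm y ^ 4 \<partial>m) + norm y ^ 4 + norm y' ^ 4)"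
    and N: "N \<ge> 1"
  shows "cube_avg {1..N} (\<lambda>S. (antithetic_difference U N (\<lambda>k. x (swap_pairs N S k)))\<^sup>2)
    \<le> 34 * C\<^sup>2 / (real N)\<^sup>2 * (1 + (\<Sum>k=1..2*N. norm (x k) ^ 8) / real N)"
proof -
  define \<phi> where "\<phi> t = U (point_masses {1..2*N} x (pair_weights N t))" for t
  define q where "q i = norm (x i) ^ 4 + norm (x (N + i)) ^ 4" for i
  define A where "A i j = C / (real N)\<^sup>2 * (1 + (\<Sum>k=1..N. q k) / real N + q i + q j)" for i j
  note second = pair_second_differences[OF V0 V C V2 N, where x = x, folded q_def \<phi>_def, folded A_def]
  have local: "\<phi> t = \<phi> t'" if agree: "\<And>i. i \<in> {1..N} \<Longrightarrow> t i = t' i" for t t'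
  proof -
    have "pair_weights N t k = pair_weights N t' k" if k: "k \<in> {1..2*N}" for k
    proof -
      have "(if k \<le> N then k else k - N) \<in> {1..N}" using k by auto
      from agree[OF this] show ?thesis by (simp add: pair_weights_def split: if_splits)
    qed
    then have "point_masses {1..2*N} x (pair_weights N t) = point_masses {1..2*N} x (pair_weights N t')"
      by (intro measure_eqI) (simp_all add: emeasure_point_masses)
    then show ?thesis by (simp add: \<phi>_def)
  qed
  have "cube_avg {1..N} (\<lambda>S. (antithetic_difference U N (\<lambda>k. x (swap_pairs N S k)))\<^sup>2)
      = cube_avg {1..N} (\<lambda>S. (\<phi> (\<lambda>_. 0) - (\<phi> (signs S) + \<phi> (signs ({1..N} - S))) / 2)\<^sup>2)"
    unfolding \<phi>_def by (intro cube_avg_cong) (simp add: antithetic_difference_swap[OF N])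
  also have "\<dots> \<le> (\<Sum>i=1..N. A i i)\<^sup>2 / 4 + (\<Sum>i=1..N. \<Sum>j=1..N. (A i j)\<^sup>2)"
    by (rule cube_antithetic[OF _ second local]) auto
  also have "\<dots> \<le> 17 * C\<^sup>2 / (real N)\<^sup>2 * (1 + (\<Sum>k=1..N. (q k)\<^sup>2) / real N)"
    unfolding A_def by (rule antithetic_constant[OF N])
  also have "\<dots> \<le> 17 * C\<^sup>2 / (real N)\<^sup>2 * (1 + (\<Sum>k=1..N. 2 * (norm (x k) ^ 8 + norm (x (N + k)) ^ 8)) / real N)"
  proof -
    have "(q k)\<^sup>2 \<le> 2 * (norm (x k) ^ 8 + norm (x (N + k)) ^ 8)" for k
    proof -
      have "0 \<le> (norm (x k) ^ 4 - norm (x (N + k)) ^ 4)\<^sup>2" by simp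
      moreover have "(norm y ^ 4)\<^sup>2 = norm y ^ 8" for y :: 'a by (simp flip: power_mult)
      ultimately show ?thesis by (simp add: q_def power2_sum power2_diff)
    qed
    then show ?thesis
      by (intro mult_left_mono add_left_mono divide_right_mono sum_mono) auto
  qed
  also have "\<dots> = 17 * C\<^sup>2 / (real N)\<^sup>2 * (1 + 2 * ((\<Sum>k=1..2*N. norm (x k) ^ 8) / real N))"
    unfolding sum_1_to_double sum_distrib_left[symmetric] by simp
  also have "\<dots> \<le> 17 * C\<^sup>2 / (real N)\<^sup>2 * (2 * (1 + (\<Sum>k=1..2*N. norm (x k) ^ 8) / real N))"
    by (intro mult_left_mono) auto
  also have "\<dots> = 34 * C\<^sup>2 / (real N)\<^sup>2 * (1 + (\<Sum>k=1..2*N. norm (x k) ^ 8) / real N)"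
  proof -
    have "17 * C\<^sup>2 / (real N)\<^sup>2 * (2 * y) = 34 * C\<^sup>2 / (real N)\<^sup>2 * y" for y by simp
    then show ?thesis .
  qed
  finally show ?thesis .
qed

section \<open>The random sample\<close>

text \<open>
  Exchangeability: the right side does not depend on the permutation \<open>f\<close>.
\<close>

lemma (in prob_space) distr_permuted_iid:
  fixes X :: "nat \<Rightarrow> 'a \<Rightarrow> 'b::euclidean_space"
  assumes J: "J \<noteq> {}" and ind: "indep_vars (\<lambda>_. borel) X J" and law: "\<And>i. i \<in> J \<Longrightarrow> distr M borel (X i) = \<mu>"
    and f: "bij_betw f J J"
  shows "distr M (\<Pi>\<^sub>M i\<in>J. borel) (\<lambda>\<omega>. \<lambda>i\<in>J. X (f i) \<omega>) = (\<Pi>\<^sub>M i\<in>J. \<mu>)"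
proof -
  have rv: "random_variable borel (X i)" if "i \<in> J" for i
    using ind that by (auto simp: indep_vars_def)
  have \<mu>: "prob_space \<mu>" "sets \<mu> = sets borel"
    using J law rv prob_space_distr by (metis ex_in_conv, metis ex_in_conv sets_distr)
  have fJ: "inj_on f J" "f \<in> J \<rightarrow> J" using f by (auto simp: bij_betw_def)
  have sets: "sets (\<Pi>\<^sub>M i\<in>J. borel) = sets (\<Pi>\<^sub>M i\<in>J. \<mu>)"
    using \<mu>(2) by (intro sets_PiM_cong) auto
  let ?p = "\<lambda>x. \<lambda>i\<in>J. x (f i)" and ?X = "\<lambda>\<omega>. \<lambda>i\<in>J. X i \<omega>"
  have X: "?X \<in> measurable M (\<Pi>\<^sub>M i\<in>J. borel)"
    using rv by (intro measurable_restrict)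
  have p: "?p \<in> measurable (\<Pi>\<^sub>M i\<in>J. borel) (\<Pi>\<^sub>M i\<in>J. borel)"
    using fJ by (intro measurable_restrict measurable_component_singleton) auto
  have "(\<lambda>\<omega>. \<lambda>i\<in>J. X (f i) \<omega>) = ?p \<circ> ?X"
    using fJ(2) by (auto simp: fun_eq_iff)
  then have "distr M (\<Pi>\<^sub>M i\<in>J. borel) (\<lambda>\<omega>. \<lambda>i\<in>J. X (f i) \<omega>)
      = distr (distr M (\<Pi>\<^sub>M i\<in>J. borel) ?X) (\<Pi>\<^sub>M i\<in>J. borel) ?p"
    by (simp only: distr_distr[OF p X])
  also have "distr M (\<Pi>\<^sub>M i\<in>J. borel) ?X = (\<Pi>\<^sub>M i\<in>J. distr M borel (X i))"
    using indep_vars_iff_distr_eq_PiM'[where X = X and M' = "\<lambda>_. borel", OF J] ind rv by simp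
  also have "\<dots> = (\<Pi>\<^sub>M i\<in>J. \<mu>)"
    using law by (intro PiM_cong) auto
  also have "distr (\<Pi>\<^sub>M i\<in>J. \<mu>) (\<Pi>\<^sub>M i\<in>J. borel) ?p = distr (\<Pi>\<^sub>M i\<in>J. \<mu>) (\<Pi>\<^sub>M i\<in>J. \<mu>) ?p"
    using sets by (intro distr_cong) auto
  also have "\<dots> = (\<Pi>\<^sub>M i\<in>J. \<mu>)"
    using \<mu>(1) fJ by (rule distr_PiM_reindex)
  finally show ?thesis .
qed

lemma empirical_cong: "(\<And>i. i \<in> J \<Longrightarrow> x i = y i) \<Longrightarrow> empirical J x = empirical J y"
  by (rule measure_eqI) (simp_all add: emeasure_empirical cong: sum.cong)

lemma antithetic_difference_cong:
  assumes "\<And>i. i \<in> {1..2*N} \<Longrightarrow> x i = y i"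
  shows "antithetic_difference U N x = antithetic_difference U N y"
proof -
  have "empirical {1..2*N} x = empirical {1..2*N} y" "empirical {1..N} x = empirical {1..N} y"
    "empirical {N+1..2*N} x = empirical {N+1..2*N} y"
    using assms by (intro empirical_cong; simp)+
  then show ?thesis by (simp add: antithetic_difference_def)
qed

text \<open>
  As a function on all sequences it is continuous, hence Borel measurable, and it depends only on
  the coordinates \<open>1, ..., 2 N\<close>. The coordinate 0 must be cut off because nothing is known
  about the random variable with that index.
\<close>

lemma measurable_antithetic_difference:
  fixes U :: "'a::euclidean_space measure \<Rightarrow> real"
  assumes V0: "\<And>m. m \<in> P2 \<Longrightarrow> V0 m [] = U m" and V: "lin_deriv 0 V0 V1" and N: "N \<ge> 1"
  shows "antithetic_difference U N \<in> borel_measurable (\<Pi>\<^sub>M i\<in>{1..2*N}. borel)"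
proof -
  have "continuous_on UNIV (antithetic_difference U N)"
    unfolding antithetic_difference_def
    by (intro continuous_intros continuous_empirical[OF _ _ V0 V]) (use N in auto)
  then have "antithetic_difference U N \<in> borel_measurable (\<Pi>\<^sub>M i\<in>UNIV. borel)"
    using borel_measurable_continuous_onI measurable_cong_sets[OF sets_PiM_equal_borel refl] by blast
  moreover have "(\<lambda>x i. if i \<in> {1..2*N} then x i else 0)
      \<in> measurable (\<Pi>\<^sub>M i\<in>{1..2*N}. borel) (\<Pi>\<^sub>M i\<in>UNIV. borel :: 'a measure)"
  proof (rule measurable_PiM_single')
    fix i :: nat
    show "(\<lambda>x. if i \<in> {1..2*N} then x i else 0) \<in> measurable (\<Pi>\<^sub>M i\<in>{1..2*N}. borel :: 'a measure) borel"
      by (cases "i \<in> {1..2*N}") (auto intro: measurable_component_singleton)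
  qed auto
  ultimately have "(\<lambda>x. antithetic_difference U N (\<lambda>i. if i \<in> {1..2*N} then x i else 0))
      \<in> borel_measurable (\<Pi>\<^sub>M i\<in>{1..2*N}. borel)"
    by (rule measurable_compose[rotated])
  moreover have "antithetic_difference U N (\<lambda>i. if i \<in> {1..2*N} then x i else 0) = antithetic_difference U N x" for x
    by (rule antithetic_difference_cong) simp
  ultimately show ?thesis by simp
qed

theorem theorem2p2:
  fixes \<mu> :: "'a::euclidean_space measure"
    and U :: "'a measure \<Rightarrow> real"
    and M :: "'w measure"
    and X :: "nat \<Rightarrow> 'w \<Rightarrow> 'a"
  assumes "\<mu> \<in> P_mom 8"
    and "U \<in> class_ML 4"
    and "prob_space M"
    and "prob_space.indep_vars M (\<lambda>_. borel) X {1..}"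
    and "\<And>i. i \<ge> 1 \<Longrightarrow> distr M borel (X i) = \<mu>"
  shows "\<exists>C>0. \<forall>N\<ge>1.
    integrable M (\<lambda>\<omega>. \<bar>U (empirical {1..2*N} (\<lambda>i. X i \<omega>))
       - 1/2 * (U (empirical {1..N} (\<lambda>i. X i \<omega>)) + U (empirical {N+1..2*N} (\<lambda>i. X i \<omega>)))\<bar> ^ 2) \<and>
    prob_space.expectation M (\<lambda>\<omega>. \<bar>U (empirical {1..2*N} (\<lambda>i. X i \<omega>))
       - 1/2 * (U (empirical {1..N} (\<lambda>i. X i \<omega>)) + U (empirical {N+1..2*N} (\<lambda>i. X i \<omega>)))\<bar> ^ 2)
      \<le> C / real N ^ 2"
proof -
  interpret prob_space M by fact
  obtain V0 V1 V2 C where V0: "\<And>m. m \<in> P2 \<Longrightarrow> V0 m [] = U m" and V: "lin_deriv 0 V0 V1" "lin_deriv 1 V1 V2"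
    and C: "C \<ge> 0" and V2: "\<And>m y y'. m \<in> P_mom 4 \<Longrightarrow>
      \<bar>V2 m [y, y']\<bar> \<le> C * (1 + (\<integral>y. norm y ^ 4 \<partial>m) + norm y ^ 4 + norm y' ^ 4)"
    using class_ML_4_second_derivative[OF assms(2)] by blast
  define m8 where "m8 = (\<integral>y. norm y ^ 8 \<partial>\<mu>)"
  have m8: "m8 \<ge> 0" by (simp add: m8_def)
  have rv: "random_variable borel (X i)" if "i \<ge> 1" for i
    using assms(4) that by (auto simp: indep_vars_def)
  have int8: "integrable M (\<lambda>\<omega>. norm (X i \<omega>) ^ 8)" and ex8: "expectation (\<lambda>\<omega>. norm (X i \<omega>) ^ 8) = m8"
    if i: "i \<ge> 1" for i
  proof -
    have "integrable (distr M borel (X i)) (\<lambda>y. norm y ^ 8)"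
      using assms(1) assms(5)[OF i] by (simp add: P_mom_def)
    then show "integrable M (\<lambda>\<omega>. norm (X i \<omega>) ^ 8)"
      using rv[OF i] by (simp add: integrable_distr_eq)
    show "expectation (\<lambda>\<omega>. norm (X i \<omega>) ^ 8) = m8"
      unfolding m8_def assms(5)[OF i, symmetric] using rv[OF i] by (subst integral_distr) auto
  qed
  let ?K = "34 * C\<^sup>2 * (1 + 2 * m8) + 1"
  have main: "integrable M (\<lambda>\<omega>. (antithetic_difference U N (\<lambda>i. X i \<omega>))\<^sup>2) \<and>
      expectation (\<lambda>\<omega>. (antithetic_difference U N (\<lambda>i. X i \<omega>))\<^sup>2) \<le> ?K / (real N)\<^sup>2" if N: "N \<ge> 1" for N
  proof -
    let ?J = "{1..2*N}" and ?I = "{1..N}"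
    let ?PJ = "\<Pi>\<^sub>M i\<in>?J. borel :: 'a measure"
    let ?h = "\<lambda>x. (antithetic_difference U N x)\<^sup>2"
    let ?Xs = "\<lambda>S \<omega> k. X (swap_pairs N S k) \<omega>"
    let ?B = "\<lambda>\<omega>. 34 * C\<^sup>2 / (real N)\<^sup>2 * (1 + (\<Sum>k=1..2*N. norm (X k \<omega>) ^ 8) / real N)"
    have J: "?J \<noteq> {}" using N by auto
    have indJ: "indep_vars (\<lambda>_. borel) X ?J"
      using assms(4) by (rule indep_vars_subset) auto
    have h: "?h \<in> borel_measurable ?PJ"
      using measurable_antithetic_difference[OF V0 V(1) N] by measurable
    have X_meas: "(\<lambda>\<omega>. \<lambda>k\<in>?J. ?Xs S \<omega> k) \<in> measurable M ?PJ" if "S \<subseteq> ?I" for S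
    proof (rule measurable_restrict)
      fix k assume "k \<in> ?J"
      then have "swap_pairs N S k \<ge> 1" using bij_swap_pairs[OF that] by (auto simp: bij_betw_def)
      then show "random_variable borel (X (swap_pairs N S k))" by (rule rv)
    qed
    have restr: "?h (\<lambda>k\<in>?J. x k) = ?h x" for x :: "nat \<Rightarrow> 'a"
      by (subst antithetic_difference_cong[where y = x]) auto
    have distr: "distr M ?PJ (\<lambda>\<omega>. \<lambda>k\<in>?J. ?Xs S \<omega> k) = (\<Pi>\<^sub>M i\<in>?J. \<mu>)" if "S \<subseteq> ?I" for S
      using J indJ assms(5) bij_swap_pairs[OF that] by (intro distr_permuted_iid) auto
    have h_meas: "(\<lambda>\<omega>. ?h (?Xs S \<omega>)) \<in> borel_measurable M" if "S \<subseteq> ?I" for S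
      using measurable_compose[OF X_meas[OF that] h] unfolding restr .
    have swap0: "?Xs {} \<omega> = (\<lambda>i. X i \<omega>)" for \<omega>
      by (simp add: swap_pairs_def)
    \<comment> \<open>Swapping pairs does not change the law of the sample, so the expected square equals the
      expected average over all swaps, to which the estimate for a fixed sample applies.\<close>
    have exch: "expectation (\<lambda>\<omega>. ?h (?Xs S \<omega>)) = expectation (\<lambda>\<omega>. ?h (\<lambda>i. X i \<omega>))" if "S \<subseteq> ?I" for S
    proof -
      have "expectation (\<lambda>\<omega>. ?h (?Xs T \<omega>)) = integral\<^sup>L (\<Pi>\<^sub>M i\<in>?J. \<mu>) ?h" if "T \<subseteq> ?I" for T
        unfolding distr[OF that, symmetric] integral_distr[OF X_meas[OF that] h] restr ..
      from this[OF that] this[of "{}"] show ?thesis by (simp add: swap0)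
    qed
    have avg: "cube_avg ?I (\<lambda>S. ?h (?Xs S \<omega>)) \<le> ?B \<omega>" for \<omega>
      by (rule cube_avg_antithetic_difference_le[OF V0 V C V2 N])
    have sum8: "integrable M (\<lambda>\<omega>. \<Sum>k=1..2*N. norm (X k \<omega>) ^ 8)"
      using int8 by (intro Bochner_Integration.integrable_sum) auto
    then have B: "integrable M ?B" by simp
    \<comment> \<open>One summand of an average of \<open>2 ^ N\<close> nonnegative terms is at most \<open>2 ^ N\<close> times the average;
      the factor depends on \<open>N\<close> but serves integrability only.\<close>
    have int: "integrable M (\<lambda>\<omega>. ?h (?Xs S \<omega>))" if S: "S \<subseteq> ?I" for S
    proof (rule Bochner_Integration.integrable_bound[OF integrable_mult_right[OF B] h_meas[OF S]])
      show "AE \<omega> in M. norm (?h (?Xs S \<omega>)) \<le> norm (2 ^ N * ?B \<omega>)"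
      proof (rule AE_I2)
        fix \<omega>
        have "?h (?Xs S \<omega>) \<le> (\<Sum>S\<in>Pow ?I. ?h (?Xs S \<omega>))"
          using S by (intro member_le_sum) auto
        also have "\<dots> = 2 ^ N * cube_avg ?I (\<lambda>S. ?h (?Xs S \<omega>))"
          by (simp add: cube_avg_def)
        also have "\<dots> \<le> 2 ^ N * ?B \<omega>" using avg by (intro mult_left_mono) auto
        finally have "?h (?Xs S \<omega>) \<le> 2 ^ N * ?B \<omega>" .
        then show "norm (?h (?Xs S \<omega>)) \<le> norm (2 ^ N * ?B \<omega>)"
          unfolding real_norm_def abs_power2 by (rule order_trans[OF _ abs_ge_self])
      qed
    qed
    have "expectation (\<lambda>\<omega>. cube_avg ?I (\<lambda>S. ?h (?Xs S \<omega>))) = cube_avg ?I (\<lambda>S. expectation (\<lambda>\<omega>. ?h (?Xs S \<omega>)))"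
      unfolding cube_avg_def using int by (simp add: Bochner_Integration.integral_sum)
    also have "\<dots> = cube_avg ?I (\<lambda>S. expectation (\<lambda>\<omega>. ?h (\<lambda>i. X i \<omega>)))"
      using exch by (rule cube_avg_cong)
    also have "\<dots> = expectation (\<lambda>\<omega>. ?h (\<lambda>i. X i \<omega>))"
      by (rule cube_avg_const) simp
    finally have "expectation (\<lambda>\<omega>. ?h (\<lambda>i. X i \<omega>)) = expectation (\<lambda>\<omega>. cube_avg ?I (\<lambda>S. ?h (?Xs S \<omega>)))" ..
    also have "\<dots> \<le> expectation ?B"
    proof (rule integral_mono[OF _ B avg])
      show "integrable M (\<lambda>\<omega>. cube_avg ?I (\<lambda>S. ?h (?Xs S \<omega>)))"
        unfolding cube_avg_def using int by (intro integrable_divide Bochner_Integration.integrable_sum) auto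
    qed
    also have "\<dots> = 34 * C\<^sup>2 / (real N)\<^sup>2 * (1 + (\<Sum>k=1..2*N. m8) / real N)"
    proof -
      have "expectation (\<lambda>\<omega>. \<Sum>k=1..2*N. norm (X k \<omega>) ^ 8) = (\<Sum>k=1..2*N. m8)"
        using int8 ex8 by (subst Bochner_Integration.integral_sum) auto
      moreover have "expectation ?B = 34 * C\<^sup>2 / (real N)\<^sup>2 *
          (1 + expectation (\<lambda>\<omega>. \<Sum>k=1..2*N. norm (X k \<omega>) ^ 8) / real N)"
        using sum8 by (subst integral_mult_right_zero, subst Bochner_Integration.integral_add) (auto simp: prob_space)
      ultimately show ?thesis by simp
    qed
    also have "\<dots> = 34 * C\<^sup>2 * (1 + 2 * m8) / (real N)\<^sup>2"
      using N by simp
    also have "\<dots> \<le> ?K / (real N)\<^sup>2"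
      by (intro divide_right_mono) auto
    finally show ?thesis using int[of "{}"] by (simp add: swap0)
  qed
  have "?K > 0" using m8 by (intro add_nonneg_pos mult_nonneg_nonneg) auto
  with main show ?thesis
    by (intro exI[of _ ?K]) (simp add: antithetic_difference_def)
qed

end
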